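(* For every ordinal $\lambda$ and any field $K$, there is an acyclic directed graph $P_\lambda$ for which the Leavitt path algebra $L_K(P_\lambda)$ is a Loewy ring of length $\lambda$.
   Context: A (directed) graph $E=(E^0,E^1,r,s)$ consists of a set $E^0$ of vertices, a set $E^1$ of edges (both of arbitrary cardinality), and maps $r,s:E^1\to E^0$ (range and source). A path is a sequence of edges $e_1\cdots e_n$ with $r(e_i)=s(e_{i+1})$. A cycle based at $v$ is a path $e_1\cdots e_n$ ($n\ge1$) with $s(e_1)=r(e_n)=v$ and $s(e_i)\ne s(e_j)$ for $i\ne j$. A graph is acyclic if it has no cycles. A vertex $v$ is regular if $s^{-1}(v)$ is nonempty and finite. The Leavitt path algebra $L_K(E)$ is the $K$-algebra generated by pairwise orthogonal idempotents $\{v:v\in E^0\}$ together with variables $\{e,e^*:e\in E^1\}$ subject to: (i) $s(e)e=er(e)=e$ for $e\in E^1$; (ii) $r(e)e^*=e^*s(e)=e^*$ for $e\in E^1$; (iii) $e^*e'=\delta_{e,e'}r(e)$ for $e,e'\in E^1$; (iv) $v=\sum_{s(e)=v}ee^*$ for every regular vertex $v$. The socle $Soc(R)$ of a ring $R$ is the sum of its simple left ideals, or $\{0\}$ if there are none (for rings with zero Jacobson radical, as occurs for all Leavitt path algebras, this equals the sum of the simple right ideals). The ascending Loewy socle series of a (not necessarily unital) ring $R$ with zero Jacobson radical is the ascending chain of two-sided ideals given by $S_0=0$, $S_{\alpha+1}/S_\alpha=Soc(R/S_\alpha)$, and $S_\gamma=\bigcup_{\alpha<\gamma}S_\alpha$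 for $\gamma$ a limit ordinal. The Loewy length of $R$ is the least ordinal $\lambda$ with $S_\lambda=S_{\lambda+1}$. $R$ is a Loewy ring if $R=S_\alpha$ for some $\alpha$. *)

theory Defs
  imports
    "HOL-Algebra.QuotRing"
    "HOL-Algebra.Generated_Groups"
    "HOL-Library.Poly_Mapping"
    "Graph_Theory.Arc_Walk"
begin

section \<open>Rings without unit and the ascending Loewy socle series\<close>

text \<open>
  The rings here need not be unital. They are given as ring records of which the field \<^term>\<open>one\<close>
  is never used, and \<^term>\<open>R Quot I\<close> from \<^theory>\<open>HOL-Algebra.QuotRing\<close> is used for them as well.
  The locales \<^locale>\<open>ring\<close> and \<^locale>\<open>ideal\<close> of the library demand a unit and cannot be used.
\<close>

definition left_ideal :: "('a, 'm) ring_scheme \<Rightarrow> 'a set \<Rightarrow> bool" where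
  "left_ideal R L \<longleftrightarrow>
     additive_subgroup L R \<and> (\<forall>a\<in>carrier R. \<forall>x\<in>L. a \<otimes>\<^bsub>R\<^esub> x \<in> L)"

definition two_sided_ideal :: "('a, 'm) ring_scheme \<Rightarrow> 'a set \<Rightarrow> bool" where
  "two_sided_ideal R I \<longleftrightarrow>
     left_ideal R I \<and> (\<forall>a\<in>carrier R. \<forall>x\<in>I. x \<otimes>\<^bsub>R\<^esub> a \<in> I)"

text \<open>
  Simplicity is minimality among the nonzero left ideals. The condition \<open>R L \<noteq> 0\<close> that is sometimes
  added in the non-unital setting is automatic when the Jacobson radical vanishes.
\<close>

definition simple_left_ideal :: "('a, 'm) ring_scheme \<Rightarrow> 'a set \<Rightarrow> bool" where
  "simple_left_ideal R L \<longleftrightarrow>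
     left_ideal R L \<and> L \<noteq> {\<zero>\<^bsub>R\<^esub>} \<and>
     (\<forall>M. left_ideal R M \<and> M \<subseteq> L \<longrightarrow> M = {\<zero>\<^bsub>R\<^esub>} \<or> M = L)"

text \<open>
  The sum of a family of left ideals is the additive subgroup generated by their union;
  for the empty family this is \<open>{0}\<close>.
\<close>

definition socle :: "('a, 'm) ring_scheme \<Rightarrow> 'a set" where
  "socle R = generate (add_monoid R) (\<Union>{L. simple_left_ideal R L})"

text \<open>
  If \<open>I = S\<^sub>\<alpha>\<close>, then \<open>loewy_step R I\<close> is \<open>S\<^bsub>\<alpha>+1\<^esub>\<close>, the preimage of the socle of \<open>R / I\<close> under the
  projection of \<open>R\<close> onto \<open>R / I\<close>.
\<close>

definition loewy_step :: "('a, 'm) ring_scheme \<Rightarrow> 'a set \<Rightarrow> 'a set" where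
  "loewy_step R I = {x \<in> carrier R. I +>\<^bsub>R\<^esub> x \<in> socle (R Quot I)}"

text \<open>
  Ordinals are represented by the elements of well-orders: if \<open>r\<close> is a well-order and \<open>a \<in> Field r\<close>,
  then \<open>a\<close> stands for the order type of \<^term>\<open>underS r a\<close>. Every ordinal is represented in this way,
  \<open>\<lambda>\<close> for instance by the greatest element of a well-order of type \<open>\<lambda> + 1\<close>.
\<close>

definition immediate_pred :: "'o rel \<Rightarrow> 'o \<Rightarrow> 'o \<Rightarrow> bool" where
  "immediate_pred r a b \<longleftrightarrow> b \<in> underS r a \<and> (\<forall>c\<in>underS r a. (c, b) \<in> r)"

definition loewy_series :: "'o rel \<Rightarrow> ('a, 'm) ring_scheme \<Rightarrow> 'o \<Rightarrow> 'a set" where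
  "loewy_series r R = wo_rel.worec r (\<lambda>S a.
     if underS r a = {} then {\<zero>\<^bsub>R\<^esub>}
     else if \<exists>b. immediate_pred r a b then loewy_step R (S (THE b. immediate_pred r a b))
     else (\<Union>b\<in>underS r a. S b))"

lemma immediate_pred_unique:
  assumes "Well_order r" "immediate_pred r a b" "immediate_pred r a c"
  shows "b = c"
proof -
  have "antisym r"
    using assms(1) by (simp add: order_on_defs)
  then show ?thesis
    using assms(2,3) by (auto simp: immediate_pred_def dest: antisymD)
qed

lemma immediate_pred_the:
  assumes "Well_order r" "immediate_pred r a b"
  shows "(THE b. immediate_pred r a b) = b"
  using assms(2) by (rule the_equality) (rule immediate_pred_unique[OF assms(1) _ assms(2)])

lemma loewy_series_unfold:
  assumes "Well_order r"
  shows "loewy_series r R a =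
    (if underS r a = {} then {\<zero>\<^bsub>R\<^esub>}
     else if \<exists>b. immediate_pred r a b
       then loewy_step R (loewy_series r R (THE b. immediate_pred r a b))
     else (\<Union>b\<in>underS r a. loewy_series r R b))"
proof -
  interpret wo_rel r
    using assms by (simp add: wo_rel_def)
  let ?H = "\<lambda>S a.
     if underS a = {} then {\<zero>\<^bsub>R\<^esub>}
     else if \<exists>b. immediate_pred r a b then loewy_step R (S (THE b. immediate_pred r a b))
     else (\<Union>b\<in>underS a. S b)"
  have "adm_wo ?H"
    unfolding adm_wo_def
  proof (intro allI impI)
    fix f g :: "'a \<Rightarrow> 'b set" and x
    assume eq: "\<forall>y\<in>underS x. f y = g y"
    have "(THE b. immediate_pred r x b) \<in> underS x" if "immediate_pred r x b" for b
      using immediate_pred_the[OF assms that] that by (simp add: immediate_pred_def)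
    then show "?H f x = ?H g x"
      using eq by auto
  qed
  then have "worec ?H = ?H (worec ?H)"
    by (rule worec_fixpoint)
  from fun_cong[OF this, of a] show ?thesis
    unfolding loewy_series_def .
qed

lemma loewy_series_zero:
  assumes "Well_order r" "underS r a = {}"
  shows "loewy_series r R a = {\<zero>\<^bsub>R\<^esub>}"
  by (subst loewy_series_unfold[OF assms(1)]) (simp add: assms(2))

lemma loewy_series_succ:
  assumes "Well_order r" "immediate_pred r a b"
  shows "loewy_series r R a = loewy_step R (loewy_series r R b)"
proof -
  have "underS r a \<noteq> {}"
    using assms(2) by (auto simp: immediate_pred_def)
  then show ?thesis
    using assms(2) immediate_pred_the[OF assms]
    by (subst loewy_series_unfold[OF assms(1)]) auto
qed

lemma loewy_series_limit:
  assumes "Well_order r" "underS r a \<noteq> {}" "\<nexists>b. immediate_pred r a b"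
  shows "loewy_series r R a = (\<Union>b\<in>underS r a. loewy_series r R b)"
  by (subst loewy_series_unfold[OF assms(1)]) (simp add: assms(2,3))

text \<open>
  \<open>l\<close> represents the least ordinal \<open>\<lambda>\<close> with \<open>S\<^sub>\<lambda> = S\<^bsub>\<lambda>+1\<^esub>\<close>. Writing \<open>S\<^bsub>\<lambda>+1\<^esub>\<close> as \<^term>\<open>loewy_step\<close> of
  \<open>S\<^sub>\<lambda>\<close> covers the case that \<open>l\<close> is the greatest element of \<open>r\<close>.
\<close>

definition has_loewy_length :: "'o rel \<Rightarrow> ('a, 'm) ring_scheme \<Rightarrow> 'o \<Rightarrow> bool" where
  "has_loewy_length r R l \<longleftrightarrow>
     l \<in> Field r \<and>
     loewy_series r R l = loewy_step R (loewy_series r R l) \<and>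
     (\<forall>a\<in>underS r l. loewy_series r R a \<noteq> loewy_step R (loewy_series r R a))"

text \<open>
  The ordinal \<open>\<alpha>\<close> with \<open>R = S\<^sub>\<alpha>\<close> is taken among those represented in \<open>r\<close>. If the Loewy length of \<open>R\<close>
  is represented in \<open>r\<close>, this is no restriction, since the series is constant from there on.
\<close>

definition loewy_ring :: "'o rel \<Rightarrow> ('a, 'm) ring_scheme \<Rightarrow> bool" where
  "loewy_ring r R \<longleftrightarrow> (\<exists>a\<in>Field r. carrier R = loewy_series r R a)"


section \<open>Leavitt path algebras\<close>

text \<open>
  Words form the free monoid, written additively because \<^theory>\<open>HOL-Library.Poly_Mapping\<close> builds
  monoid algebras over additive monoids. Thus \<open>'x word \<Rightarrow>\<^sub>0 'k\<close> is the free unital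
  associative \<open>'k\<close>-algebra on \<open>'x\<close>.
\<close>

datatype 'x word = Word (letters: "'x list")

instantiation word :: (type) monoid_add
begin

definition zero_word :: "'a word" where
  "0 = Word []"

definition plus_word :: "'a word \<Rightarrow> 'a word \<Rightarrow> 'a word" where
  "u + w = Word (letters u @ letters w)"

instance
  by standard (simp_all add: zero_word_def plus_word_def)

end

datatype ('v, 'e) generator = Vertex 'v | Edge 'e | Ghost 'e

type_synonym ('v, 'e, 'k) free_algebra = "('v, 'e) generator word \<Rightarrow>\<^sub>0 'k"

text \<open>
  In a graph \<open>G\<close> of type \<^typ>\<open>('v, 'e) pre_digraph\<close> the source map is \<^term>\<open>tail G\<close> and the range
  map is \<^term>\<open>head G\<close>. Since \<open>L\<^sub>K(G)\<close> has no unit in general, it is a quotient of the free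
  non-unital algebra on the generators, whose elements have no constant term.
\<close>

definition generators :: "('v, 'e) pre_digraph \<Rightarrow> ('v, 'e) generator set" where
  "generators G = Vertex ` verts G \<union> Edge ` arcs G \<union> Ghost ` arcs G"

definition free_nonunital_algebra ::
  "'k::field itself \<Rightarrow> ('v, 'e) pre_digraph \<Rightarrow> ('v, 'e, 'k) free_algebra ring" where
  "free_nonunital_algebra K G =
     \<lparr>carrier = {p. \<forall>w\<in>Poly_Mapping.keys p. letters w \<noteq> [] \<and> set (letters w) \<subseteq> generators G},
      mult = (*), one = undefined, zero = 0, add = (+)\<rparr>"

definition gen :: "('v, 'e) generator \<Rightarrow> ('v, 'e, 'k::field) free_algebra" where
  "gen x = Poly_Mapping.single (Word [x]) 1"

definition scale :: "'k::field \<Rightarrow> ('v, 'e, 'k) free_algebra \<Rightarrow> ('v, 'e, 'k) free_algebra" where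
  "scale c p = Poly_Mapping.single 0 c * p"

definition regular_vertex :: "('v, 'e) pre_digraph \<Rightarrow> 'v \<Rightarrow> bool" where
  "regular_vertex G v \<longleftrightarrow> v \<in> verts G \<and> out_arcs G v \<noteq> {} \<and> finite (out_arcs G v)"

definition leavitt_relators ::
  "'k::field itself \<Rightarrow> ('v, 'e) pre_digraph \<Rightarrow> ('v, 'e, 'k) free_algebra set" where
  "leavitt_relators K G =
     {gen (Vertex v) * gen (Vertex w) - (if v = w then gen (Vertex v) else 0) | v w.
        v \<in> verts G \<and> w \<in> verts G} \<union>
     {gen (Vertex (tail G e)) * gen (Edge e) - gen (Edge e) | e. e \<in> arcs G} \<union>
     {gen (Edge e) * gen (Vertex (head G e)) - gen (Edge e) | e. e \<in> arcs G} \<union>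
     {gen (Vertex (head G e)) * gen (Ghost e) - gen (Ghost e) | e. e \<in> arcs G} \<union>
     {gen (Ghost e) * gen (Vertex (tail G e)) - gen (Ghost e) | e. e \<in> arcs G} \<union>
     {gen (Ghost e) * gen (Edge f) - (if e = f then gen (Vertex (head G e)) else 0) | e f.
        e \<in> arcs G \<and> f \<in> arcs G} \<union>
     {gen (Vertex v) - (\<Sum>e\<in>out_arcs G v. gen (Edge e) * gen (Ghost e)) | v.
        regular_vertex G v}"

text \<open>
  The ideal generated by the relators as an ideal of a \<open>K\<close>-algebra: without a unit, ring ideals
  need not be closed under scalars.
\<close>

definition leavitt_ideal ::
  "'k::field itself \<Rightarrow> ('v, 'e) pre_digraph \<Rightarrow> ('v, 'e, 'k) free_algebra set" where
  "leavitt_ideal K G =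
     \<Inter>{I. two_sided_ideal (free_nonunital_algebra K G) I \<and>
         (\<forall>c. \<forall>x\<in>I. scale c x \<in> I) \<and> leavitt_relators K G \<subseteq> I}"

definition leavitt_path_algebra ::
  "'k::field itself \<Rightarrow> ('v, 'e) pre_digraph \<Rightarrow> ('v, 'e, 'k) free_algebra set ring" where
  "leavitt_path_algebra K G = free_nonunital_algebra K G Quot leavitt_ideal K G"

end

theory Submission
  imports Defs
begin

text \<open>
  The graph has the ordinals below \<open>\<lambda>\<close> as vertices and infinitely many edges from \<open>\<beta>\<close> to \<open>\<alpha>\<close> whenever
  \<open>\<alpha> < \<beta>\<close>. It has no regular vertex, so the monomials \<open>p q\<^sup>*\<close>, for paths \<open>p\<close>, \<open>q\<close> with a common range,
  form a basis of the Leavitt path algebra, and \<open>S\<^sub>\<alpha>\<close> turns out to be the span of those with range below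
  \<open>\<alpha>\<close>. Linear independence is read off from the action on paths, \<open>p q\<^sup>*\<close> sending \<open>q b\<close> to \<open>p b\<close>: because
  there are infinitely many edges to \<open>\<alpha>\<close>, an element is in \<open>S\<^sub>\<alpha>\<close> iff it annihilates the paths with
  range \<open>\<alpha>\<close>. Modulo \<open>S\<^sub>\<alpha>\<close> the vertex \<open>\<alpha>\<close> is a sink, whence the monomials \<open>p q\<^sup>*\<close> with range \<open>\<alpha>\<close> multiply
  like matrix units and the columns, for fixed \<open>q\<close>, are simple left ideals. Their sum meets every
  nonzero left ideal, hence it is the socle of the quotient by \<open>S\<^sub>\<alpha>\<close>.
\<close>

section \<open>Socles of quotients of rings without unit\<close>

text \<open>Two quotients are stacked: the algebra is a quotient of a free algebra, and each further
  term of the series is read off in a quotient of that quotient. Every ideal is therefore replaced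
  by its preimage in the free algebra, and the conditions on socles become memberships there, which
  the action on paths decides. The infinitely many parallel edges do two jobs. They rule out regular
  vertices, so relation (iv), which the action on paths would violate, is vacuous. They also make
  the range \<alpha> a faithful test: if the successor \<beta> of \<alpha> had only finitely many
  edges e to \<alpha>, and infinitely many to smaller ordinals, then \<beta> minus the sum of the e
  e* would kill all paths with range \<alpha> without being in the span of the monomials with range
  below \<alpha>. Joining all pairs \<alpha> < \<beta> at once avoids a recursion on \<lambda>: at a
  limit ordinal the union comes from the finiteness of supports.\<close>

locale nonunital_ring = abelian_group R for R (structure) +
  assumes m_closed [simp, intro]: "\<lbrakk>x \<in> carrier R; y \<in> carrier R\<rbrakk> \<Longrightarrow> x \<otimes> y \<in> carrier R"
    and m_assoc: "\<lbrakk>x \<in> carrier R; y \<in> carrier R; z \<in> carrier R\<rbrakk> \<Longrightarrow> (x \<otimes> y) \<otimes> z = x \<otimes> (y \<otimes> z)"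
    and l_distr: "\<lbrakk>x \<in> carrier R; y \<in> carrier R; z \<in> carrier R\<rbrakk> \<Longrightarrow> (x \<oplus> y) \<otimes> z = x \<otimes> z \<oplus> y \<otimes> z"
    and r_distr: "\<lbrakk>x \<in> carrier R; y \<in> carrier R; z \<in> carrier R\<rbrakk> \<Longrightarrow> z \<otimes> (x \<oplus> y) = z \<otimes> x \<oplus> z \<otimes> y"
begin

lemma additive_subgroup_iff:
  "additive_subgroup A R \<longleftrightarrow>
     A \<subseteq> carrier R \<and> \<zero> \<in> A \<and> (\<forall>x\<in>A. \<forall>y\<in>A. x \<oplus> y \<in> A) \<and> (\<forall>x\<in>A. \<ominus> x \<in> A)"
proof -
  interpret A: group "add_monoid R"
    by (rule a_group)
  show ?thesis
    unfolding additive_subgroup_def subgroup_def a_inv_def by auto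
qed

lemma left_idealI:
  assumes "A \<subseteq> carrier R" "\<zero> \<in> A" "\<And>x y. \<lbrakk>x \<in> A; y \<in> A\<rbrakk> \<Longrightarrow> x \<oplus> y \<in> A"
    and "\<And>x. x \<in> A \<Longrightarrow> \<ominus> x \<in> A" "\<And>a x. \<lbrakk>a \<in> carrier R; x \<in> A\<rbrakk> \<Longrightarrow> a \<otimes> x \<in> A"
  shows "left_ideal R A"
  using assms by (auto simp: left_ideal_def additive_subgroup_iff)

lemma left_idealD:
  assumes "left_ideal R A"
  shows "A \<subseteq> carrier R" "\<zero> \<in> A" "\<And>x y. \<lbrakk>x \<in> A; y \<in> A\<rbrakk> \<Longrightarrow> x \<oplus> y \<in> A"
    and "\<And>x. x \<in> A \<Longrightarrow> \<ominus> x \<in> A" "\<And>a x. \<lbrakk>a \<in> carrier R; x \<in> A\<rbrakk> \<Longrightarrow> a \<otimes> x \<in> A"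
    and "\<And>x y. \<lbrakk>x \<in> A; y \<in> A\<rbrakk> \<Longrightarrow> x \<ominus> y \<in> A"
  using assms by (auto simp: left_ideal_def additive_subgroup_iff a_minus_def)

lemma two_sided_idealD:
  assumes "two_sided_ideal R A"
  shows "left_ideal R A" "\<And>a x. \<lbrakk>a \<in> carrier R; x \<in> A\<rbrakk> \<Longrightarrow> x \<otimes> a \<in> A"
  using assms by (auto simp: two_sided_ideal_def)

lemma l_null: "x \<in> carrier R \<Longrightarrow> \<zero> \<otimes> x = \<zero>"
  by (metis add.l_cancel_one' m_closed l_distr zero_closed l_zero)

lemma l_minus: "\<lbrakk>x \<in> carrier R; y \<in> carrier R\<rbrakk> \<Longrightarrow> (\<ominus> x) \<otimes> y = \<ominus> (x \<otimes> y)"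
  by (metis a_inv_closed m_closed minus_equality l_distr l_neg l_null)

end

text \<open>Serves for the projection of the free algebra onto its quotient, for a further quotient
  map, and for the composite of both. The composite is what lets conditions on a socle be tested on
  representatives in \<open>G\<close>.\<close>

locale nonunital_ring_epi = G: nonunital_ring G + H: nonunital_ring H + abelian_group_hom G H h
    for G (structure) and H (structure) and h +
  assumes hom_mult: "\<lbrakk>x \<in> carrier G; y \<in> carrier G\<rbrakk> \<Longrightarrow> h (x \<otimes> y) = h x \<otimes>\<^bsub>H\<^esub> h y"
    and hom_surj: "h ` carrier G = carrier H"

locale quotient_by_ideal = nonunital_ring R for R (structure) +
  fixes I
  assumes ideal: "two_sided_ideal R I"
begin

sublocale abelian_subgroup I R
proof (rule abelian_subgroupI3)
  show "additive_subgroup I R"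
    using ideal by (simp add: two_sided_ideal_def left_ideal_def)
qed (rule abelian_group_axioms)

lemma rcos_eq_iff:
  assumes "x \<in> carrier R" "y \<in> carrier R"
  shows "I +> x = I +> y \<longleftrightarrow> x \<ominus> y \<in> I"
proof
  assume "I +> x = I +> y"
  then have "I +> (x \<ominus> y) = I"
    using a_coset_add_inv2 assms a_subset by (simp add: a_minus_def)
  then show "x \<ominus> y \<in> I"
    using a_coset_join1 assms a_subgroup by simp
next
  assume "x \<ominus> y \<in> I"
  then have "I +> (x \<ominus> y) = I"
    using a_coset_join2 assms a_subgroup by simp
  then show "I +> x = I +> y"
    using a_coset_add_inv1 assms a_subset by (simp add: a_minus_def)
qed

text \<open>The product of two cosets is a union over all representatives, and (i + x)(j + y)
  differs from x y by i (j + y) + x j, which lies in the two-sided ideal. So all cosets in the union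
  coincide.\<close>

lemma rcoset_mult_rcos:
  assumes "x \<in> carrier R" "y \<in> carrier R"
  shows "[mod I:] (I +> x) \<Otimes> (I +> y) = I +> (x \<otimes> y)"
proof -
  note I = two_sided_idealD[OF ideal]
  note L = left_idealD[OF I(1)]
  have *: "I +> (a \<otimes> b) = I +> (x \<otimes> y)" if ab: "a \<in> I +> x" "b \<in> I +> y" for a b
  proof -
    obtain i j where ij: "i \<in> I" "j \<in> I" "a = i \<oplus> x" "b = j \<oplus> y"
      using ab unfolding a_r_coset_def' by blast
    have ij': "i \<in> carrier R" "j \<in> carrier R"
      using ij L(1) by auto
    have "a \<otimes> b = (i \<otimes> (j \<oplus> y) \<oplus> x \<otimes> j) \<oplus> x \<otimes> y"
      using ij ij' assms by (simp add: l_distr r_distr a_ac)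
    moreover have "i \<otimes> (j \<oplus> y) \<oplus> x \<otimes> j \<in> I"
      using L(3)[OF I(2)[of "j \<oplus> y" i] L(5)[of x j]] ij ij' assms by simp
    ultimately have "a \<otimes> b \<in> I +> (x \<otimes> y)"
      by (auto simp: a_r_coset_def')
    then show ?thesis
      using a_repr_independence[of "a \<otimes> b" I "x \<otimes> y"] assms a_subgroup by simp
  qed
  have "x \<in> I +> x" "y \<in> I +> y"
    using assms by (auto intro: a_rcos_self)
  then show ?thesis
    unfolding rcoset_mult_def using * by blast
qed

lemma quotient_epi: "nonunital_ring_epi R (R Quot I) ((+>) I)"
proof -
  have car: "carrier (R Quot I) = (+>) I ` carrier R"
    by (auto simp: FactRing_def A_RCOSETS_def')
  have add: "add (R Quot I) = set_add R" and mult: "mult (R Quot I) = rcoset_mult R I"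
    by (simp_all add: FactRing_def)
  have "abelian_group (R Quot I)"
    by (rule comm_group_abelian_groupI)
      (simp add: FactRing_def a_factorgroup_is_comm_group[unfolded A_FactGroup_def'])
  then have Q: "nonunital_ring (R Quot I)"
    by (intro nonunital_ring.intro nonunital_ring_axioms.intro)
      (auto simp: car add mult a_rcos_sum rcoset_mult_rcos m_assoc l_distr r_distr)
  interpret Q: nonunital_ring "R Quot I"
    by (rule Q)
  have "abelian_group_hom R (R Quot I) ((+>) I)"
    by (intro abelian_group_homI abelian_group_axioms Q.abelian_group_axioms
        group_hom.intro group_hom_axioms.intro a_group Q.a_group homI)
      (auto simp: car add a_rcos_sum)
  then show ?thesis
    by (intro nonunital_ring_epi.intro nonunital_ring_epi_axioms.intro Q nonunital_ring_axioms)
      (auto simp: car mult rcoset_mult_rcos)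
qed

lemma rcos_eq_zero_iff: "x \<in> carrier R \<Longrightarrow> I +> x = \<zero>\<^bsub>R Quot I\<^esub> \<longleftrightarrow> x \<in> I"
  using a_coset_join1[of I x] a_coset_join2[of x I] a_subgroup by (auto simp: FactRing_def)

end

section \<open>Socles and Loewy steps transported along an epimorphism\<close>

context nonunital_ring_epi
begin

lemma hom_minus: "\<lbrakk>x \<in> carrier G; y \<in> carrier G\<rbrakk> \<Longrightarrow> h (x \<ominus> y) = h x \<ominus>\<^bsub>H\<^esub> h y"
  by (simp add: a_minus_def)

lemma left_ideal_image:
  assumes "left_ideal G A"
  shows "left_ideal H (h ` A)"
proof -
  note A = G.left_idealD[OF assms]
  have [simp]: "x \<in> A \<Longrightarrow> x \<in> carrier G" for x
    using A(1) by blast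
  show ?thesis
  proof (rule H.left_idealI)
    show "h ` A \<subseteq> carrier H"
      by auto
    show "\<zero>\<^bsub>H\<^esub> \<in> h ` A"
      using A(2) hom_zero by (metis imageI)
    show "x \<oplus>\<^bsub>H\<^esub> y \<in> h ` A" if "x \<in> h ` A" "y \<in> h ` A" for x y
      using that A(3) by (force simp flip: hom_add)
    show "\<ominus>\<^bsub>H\<^esub> x \<in> h ` A" if "x \<in> h ` A" for x
      using that A(4) by (force simp flip: hom_a_inv)
    show "a \<otimes>\<^bsub>H\<^esub> x \<in> h ` A" if "a \<in> carrier H" "x \<in> h ` A" for a x
      using that A(5) by (force simp flip: hom_surj hom_mult)
  qed
qed

lemma two_sided_ideal_image:
  assumes "two_sided_ideal G A"
  shows "two_sided_ideal H (h ` A)"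
proof -
  note A = G.two_sided_idealD[OF assms]
  have "A \<subseteq> carrier G"
    using G.left_idealD(1) A(1) .
  then show ?thesis
    unfolding two_sided_ideal_def
    using left_ideal_image[OF A(1)] A(2) by (force simp flip: hom_surj hom_mult)
qed

text \<open>
  An ideal \<open>h ` I\<close> which meets every nonzero left ideal contains the socle; conversely it is
  contained in the socle as soon as it is the sum of the left ideals generated by
  the elements \<open>h n\<close>, each of which lies in the left ideal generated by any of its nonzero multiples.
\<close>
lemma socle_eq_image:
  assumes I: "left_ideal G I"
    and essential: "\<And>x. \<lbrakk>x \<in> carrier G; h x \<noteq> \<zero>\<^bsub>H\<^esub>\<rbrakk> \<Longrightarrow> \<exists>a\<in>carrier G. a \<otimes> x \<in> I \<and> h (a \<otimes> x) \<noteq> \<zero>\<^bsub>H\<^esub>"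
    and N: "N \<subseteq> I"
    and nonzero: "\<And>n. n \<in> N \<Longrightarrow> h n \<noteq> \<zero>\<^bsub>H\<^esub>"
    and self: "\<And>n. n \<in> N \<Longrightarrow> \<exists>a\<in>carrier G. h (a \<otimes> n) = h n"
    and return: "\<And>n a. \<lbrakk>n \<in> N; a \<in> carrier G; h (a \<otimes> n) \<noteq> \<zero>\<^bsub>H\<^esub>\<rbrakk> \<Longrightarrow>
      \<exists>b\<in>carrier G. h (b \<otimes> (a \<otimes> n)) = h n"
    and span: "h ` I \<subseteq> generate (add_monoid H) (\<Union>n\<in>N. {h (a \<otimes> n) | a. a \<in> carrier G})"
  shows "socle H = h ` I"
proof
  note I' = G.left_idealD[OF I] and hI = left_ideal_image[OF I]
  show "socle H \<subseteq> h ` I"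
    unfolding socle_def
  proof (rule H.add.generate_subgroup_incl)
    show "subgroup (h ` I) (add_monoid H)"
      using hI by (simp add: left_ideal_def additive_subgroup_def)
    show "\<Union> {L. simple_left_ideal H L} \<subseteq> h ` I"
    proof clarify
      fix L y
      assume L: "simple_left_ideal H L" and y: "y \<in> L"
      then have L': "left_ideal H L" "L \<noteq> {\<zero>\<^bsub>H\<^esub>}"
        and min: "\<And>M. left_ideal H M \<Longrightarrow> M \<subseteq> L \<Longrightarrow> M = {\<zero>\<^bsub>H\<^esub>} \<or> M = L"
        by (auto simp: simple_left_ideal_def)
      note LD = H.left_idealD[OF L'(1)]
      obtain z where z: "z \<in> L" "z \<noteq> \<zero>\<^bsub>H\<^esub>"
        using L'(2) LD(2) by blast
      then obtain x where x: "x \<in> carrier G" "z = h x"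
        using LD(1) hom_surj by blast
      obtain a where a: "a \<in> carrier G" "a \<otimes> x \<in> I" "h (a \<otimes> x) \<noteq> \<zero>\<^bsub>H\<^esub>"
        using essential[OF x(1)] z(2) x(2) by auto
      have "h (a \<otimes> x) \<in> L"
        using a x z LD(5)[of "h a" z] by (simp add: hom_mult)
      then have "h (a \<otimes> x) \<in> L \<inter> h ` I"
        using a(2) by simp
      \<comment> \<open>Essentiality has put a nonzero element of \<open>L\<close> into the
        intersection, so minimality forces \<open>L\<close> into the image of
        \<open>I\<close>.\<close>
      moreover have "left_ideal H (L \<inter> h ` I)"
        by (rule H.left_idealI) (use LD H.left_idealD(2-5)[OF hI] in \<open>auto simp: subset_iff\<close>)
      ultimately have "L \<inter> h ` I = L"
        using min[of "L \<inter> h ` I"] a(3) by blast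
      then show "y \<in> h ` I"
        using y by blast
    qed
  qed
  show "h ` I \<subseteq> socle H"
  proof -
    have "simple_left_ideal H {h (a \<otimes> n) | a. a \<in> carrier G}" (is "simple_left_ideal H ?L")
      if n: "n \<in> N" for n
    proof -
      have nG: "n \<in> carrier G"
        using n N I'(1) by blast
      have L: "left_ideal H ?L"
      proof (rule H.left_idealI)
        show "?L \<subseteq> carrier H"
          using nG by auto
        show "\<zero>\<^bsub>H\<^esub> \<in> ?L"
          using nG G.l_null[of n] hom_zero by (auto intro!: exI[of _ "\<zero>"])
        show "x \<oplus>\<^bsub>H\<^esub> y \<in> ?L" if xy: "x \<in> ?L" "y \<in> ?L" for x y
        proof -
          obtain a b where "a \<in> carrier G" "b \<in> carrier G" "x = h (a \<otimes> n)" "y = h (b \<otimes> n)"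
            using xy by blast
          then have "x \<oplus>\<^bsub>H\<^esub> y = h ((a \<oplus> b) \<otimes> n)" "a \<oplus> b \<in> carrier G"
            using nG by (simp_all add: G.l_distr)
          then show ?thesis by blast
        qed
        show "\<ominus>\<^bsub>H\<^esub> x \<in> ?L" if x: "x \<in> ?L" for x
        proof -
          obtain a where "a \<in> carrier G" "x = h (a \<otimes> n)"
            using x by blast
          then have "\<ominus>\<^bsub>H\<^esub> x = h ((\<ominus> a) \<otimes> n)" "\<ominus> a \<in> carrier G"
            using nG by (simp_all add: G.l_minus)
          then show ?thesis by blast
        qed
        show "b \<otimes>\<^bsub>H\<^esub> x \<in> ?L" if bx: "b \<in> carrier H" "x \<in> ?L" for b x
        proof -
          obtain a c where "a \<in> carrier G" "c \<in> carrier G" "x = h (a \<otimes> n)" "b = h c"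
            using bx hom_surj by blast
          then have "b \<otimes>\<^bsub>H\<^esub> x = h ((c \<otimes> a) \<otimes> n)" "c \<otimes> a \<in> carrier G"
            using nG by (simp_all add: G.m_assoc flip: hom_mult)
          then show ?thesis by blast
        qed
      qed
      \<comment> \<open>Without a unit, a generator need not be among its own multiples;
        \<open>self\<close> supplies this.\<close>
      have hn: "h n \<in> ?L"
        using self[OF n] by force
      show ?thesis
        unfolding simple_left_ideal_def
      proof (intro conjI allI impI L)
        show "?L \<noteq> {\<zero>\<^bsub>H\<^esub>}"
          using nonzero[OF n] hn by blast
        fix M
        assume M: "left_ideal H M \<and> M \<subseteq> ?L"
        note MD = H.left_idealD[OF conjunct1[OF M]]
        have "M = ?L" if neq: "M \<noteq> {\<zero>\<^bsub>H\<^esub>}"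
        proof -
          obtain y where y: "y \<in> M" "y \<noteq> \<zero>\<^bsub>H\<^esub>"
            using neq MD(2) by blast
          then obtain a where a: "a \<in> carrier G" "y = h (a \<otimes> n)"
            using M by blast
          obtain b where b: "b \<in> carrier G" "h (b \<otimes> (a \<otimes> n)) = h n"
            using return[OF n a(1)] y a by blast
          have "h n = h b \<otimes>\<^bsub>H\<^esub> y"
            using a b nG by (simp add: hom_mult)
          then have "h n \<in> M"
            using MD(5)[of "h b" y] y b by simp
          then have "?L \<subseteq> M"
            using MD(5) nG by (auto simp: hom_mult)
          then show ?thesis
            using M by blast
        qed
        then show "M = {\<zero>\<^bsub>H\<^esub>} \<or> M = ?L"
          by blast
      qed
    qed
    then have "(\<Union>n\<in>N. {h (a \<otimes> n) | a. a \<in> carrier G}) \<subseteq> \<Union> {L. simple_left_ideal H L}"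
      by blast
    then show ?thesis
      unfolding socle_def using span H.add.mono_generate by blast
  qed
qed

text \<open>A left ideal containing the kernel is saturated: elements with the same image differ by
  an element of the kernel.\<close>

lemma image_mem_iff:
  assumes "left_ideal G A" "\<And>x. \<lbrakk>x \<in> carrier G; h x = \<zero>\<^bsub>H\<^esub>\<rbrakk> \<Longrightarrow> x \<in> A" "x \<in> carrier G"
  shows "h x \<in> h ` A \<longleftrightarrow> x \<in> A"
proof
  note A = G.left_idealD[OF assms(1)]
  assume "h x \<in> h ` A"
  then obtain a where a: "a \<in> A" "h x = h a"
    by blast
  then have aG: "a \<in> carrier G"
    using A(1) by blast
  have "h (x \<ominus> a) = \<zero>\<^bsub>H\<^esub>"
    using a aG assms(3) by (simp add: hom_minus a_minus_def H.r_neg)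
  then have "x \<ominus> a \<in> A"
    using assms aG by simp
  then have "(x \<ominus> a) \<oplus> a \<in> A"
    using A(3) a by blast
  then show "x \<in> A"
    using aG assms(3) by (simp add: a_minus_def G.a_assoc G.l_neg)
qed auto

text \<open>\<open>socle_eq_image\<close> is applied to the composite of \<open>h\<close> with the
  projection modulo the image of \<open>A\<close>. Its kernel is \<open>A\<close>, so vanishing,
  equality and generation in the quotient turn into statements modulo \<open>A\<close> inside
  \<open>G\<close>.\<close>

lemma loewy_step_image:
  assumes A: "two_sided_ideal G A" and B: "left_ideal G B" and AB: "A \<subseteq> B"
    and ker: "\<And>x. \<lbrakk>x \<in> carrier G; h x = \<zero>\<^bsub>H\<^esub>\<rbrakk> \<Longrightarrow> x \<in> A"
    and essential: "\<And>x. \<lbrakk>x \<in> carrier G; x \<notin> A\<rbrakk> \<Longrightarrow> \<exists>a\<in>carrier G. a \<otimes> x \<in> B \<and> a \<otimes> x \<notin> A"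
    and N: "N \<subseteq> B" "\<And>n. n \<in> N \<Longrightarrow> n \<notin> A"
    and self: "\<And>n. n \<in> N \<Longrightarrow> \<exists>a\<in>carrier G. a \<otimes> n \<ominus> n \<in> A"
    and return: "\<And>n a. \<lbrakk>n \<in> N; a \<in> carrier G; a \<otimes> n \<notin> A\<rbrakk> \<Longrightarrow>
      \<exists>b\<in>carrier G. b \<otimes> (a \<otimes> n) \<ominus> n \<in> A"
    and span: "B \<subseteq> generate (add_monoid G) (A \<union> (\<Union>n\<in>N. {a \<otimes> n | a. a \<in> carrier G}))"
  shows "loewy_step H (h ` A) = h ` B"
proof -
  note AD = G.two_sided_idealD[OF A]
  note BD = G.left_idealD[OF B]
  interpret Q: quotient_by_ideal H "h ` A"
    by unfold_locales (rule two_sided_ideal_image[OF A])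
  let ?Q = "H Quot (h ` A)" and ?k = "\<lambda>x. (h ` A) +>\<^bsub>H\<^esub> h x"
  interpret q: nonunital_ring_epi H ?Q "(+>\<^bsub>H\<^esub>) (h ` A)"
    by (rule Q.quotient_epi)
  interpret k: nonunital_ring_epi G ?Q ?k
  proof (intro nonunital_ring_epi.intro nonunital_ring_epi_axioms.intro abelian_group_homI
      group_hom.intro group_hom_axioms.intro homI G.nonunital_ring_axioms q.H.nonunital_ring_axioms
      G.abelian_group_axioms q.H.abelian_group_axioms G.a_group q.H.a_group)
    show "?k ` carrier G = carrier ?Q"
      using hom_surj q.hom_surj by (metis image_image)
  qed (auto simp: hom_mult q.hom_mult)
  have zero: "?k x = \<zero>\<^bsub>?Q\<^esub> \<longleftrightarrow> x \<in> A" if "x \<in> carrier G" for x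
    using that by (simp add: Q.rcos_eq_zero_iff image_mem_iff[OF AD(1) ker])
  have eq: "?k x = ?k y \<longleftrightarrow> x \<ominus> y \<in> A" if "x \<in> carrier G" "y \<in> carrier G" for x y
    using that by (simp add: Q.rcos_eq_iff image_mem_iff[OF AD(1) ker] flip: hom_minus)
  have NG: "n \<in> carrier G" if "n \<in> N" for n
    using that N BD(1) by blast
  have "socle ?Q = ?k ` B"
  proof (rule k.socle_eq_image[where N = N, OF B])
    show "\<exists>a\<in>carrier G. a \<otimes> x \<in> B \<and> ?k (a \<otimes> x) \<noteq> \<zero>\<^bsub>?Q\<^esub>"
      if "x \<in> carrier G" "?k x \<noteq> \<zero>\<^bsub>?Q\<^esub>" for x
      using essential[of x] that by (metis G.m_closed zero)
    show "?k n \<noteq> \<zero>\<^bsub>?Q\<^esub>" if "n \<in> N" for n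
      using that NG N(2) zero by blast
    show "\<exists>a\<in>carrier G. ?k (a \<otimes> n) = ?k n" if "n \<in> N" for n
      using self[OF that] NG[OF that] by (metis eq G.m_closed)
    show "\<exists>b\<in>carrier G. ?k (b \<otimes> (a \<otimes> n)) = ?k n"
      if "n \<in> N" "a \<in> carrier G" "?k (a \<otimes> n) \<noteq> \<zero>\<^bsub>?Q\<^esub>" for n a
      using return[OF that(1,2)] NG[OF that(1)] that by (metis zero eq G.m_closed)
    show "?k ` B \<subseteq> generate (add_monoid ?Q) (\<Union>n\<in>N. {?k (a \<otimes> n) | a. a \<in> carrier G})" (is "_ \<subseteq> ?S")
    proof -
      let ?U = "A \<union> (\<Union>n\<in>N. {a \<otimes> n | a. a \<in> carrier G})"
      have AG: "A \<subseteq> carrier G"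
        using G.left_idealD(1)[OF AD(1)] .
      have U: "?U \<subseteq> carrier G"
        using AG NG by auto
      have S: "subgroup ?S (add_monoid ?Q)"
        by (rule q.H.add.generate_is_subgroup) (use NG in auto)
      have zS: "\<zero>\<^bsub>?Q\<^esub> \<in> ?S"
        using subgroup.one_closed[OF S] by (simp only: monoid.simps)
      \<comment> \<open>Including \<open>A\<close> among the generators costs nothing, since it is
        sent to zero.\<close>
      have "?k x \<in> ?S" if x: "x \<in> ?U" for x
      proof (cases "x \<in> A")
        case True
        with AG have "?k x = \<zero>\<^bsub>?Q\<^esub>"
          by (subst zero) auto
        then show ?thesis
          using zS by (simp only:)
      next
        case False
        then obtain n a where "n \<in> N" "a \<in> carrier G" "x = a \<otimes> n"
          using x by blast
        then show ?thesis
          by (intro generate.incl) blast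
      qed
      then have "?k ` ?U \<subseteq> ?S"
        by (rule image_subsetI)
      then have L: "generate (add_monoid ?Q) (?k ` ?U) \<subseteq> ?S"
        by (rule q.H.add.generate_subgroup_incl[OF _ S])
      have E: "generate (add_monoid ?Q) (?k ` ?U) = ?k ` generate (add_monoid G) ?U"
        by (rule group_hom.generate_img[OF k.a_group_hom]) (simp only: partial_object.simps U)
      show ?thesis
        by (rule order.trans[OF image_mono[OF span]], rule L[unfolded E])
    qed
  qed (rule N)
  then have "x \<in> loewy_step H (h ` A) \<longleftrightarrow> x \<in> carrier H \<and> (\<exists>y\<in>B. (h ` A) +>\<^bsub>H\<^esub> x = ?k y)" for x
    unfolding loewy_step_def by auto
  moreover have "x \<in> h ` B \<longleftrightarrow> x \<in> carrier H \<and> (\<exists>y\<in>B. (h ` A) +>\<^bsub>H\<^esub> x = ?k y)" for x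
  proof
    assume *: "x \<in> carrier H \<and> (\<exists>y\<in>B. (h ` A) +>\<^bsub>H\<^esub> x = ?k y)"
    then obtain z where z: "z \<in> carrier G" "x = h z"
      using hom_surj by (metis imageE)
    with * obtain y where zy: "z \<in> carrier G" "x = h z" "y \<in> B" "?k z = ?k y"
      by metis
    then have y: "y \<in> carrier G"
      using BD(1) by blast
    \<comment> \<open>Equal classes mean a difference in \<open>A\<close>, which is contained in
      \<open>B\<close>; so \<open>B\<close> is the full preimage of its image in the
      quotient.\<close>
    then have "z \<ominus> y \<in> B"
      using zy eq[of z y] AB by auto
    then have "(z \<ominus> y) \<oplus> y \<in> B"
      using zy(3) BD(3) by simp
    then have "z \<in> B"
      using zy(1) y by (simp add: a_minus_def G.a_assoc G.l_neg)
    then show "x \<in> h ` B"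
      using zy by blast
  qed (use BD(1) in auto)
  ultimately show ?thesis
    by blast
qed

end

section \<open>The action on paths\<close>

text \<open>The linear functional with values \<open>g\<close> on the monomials. Scalar values
  suffice, as vectors in the space of paths are only observed through functionals.\<close>

definition linear_extend :: "('w \<Rightarrow> 'k) \<Rightarrow> ('w \<Rightarrow>\<^sub>0 'k) \<Rightarrow> 'k::field" where
  "linear_extend g x = (\<Sum>w\<in>Poly_Mapping.keys x. Poly_Mapping.lookup x w * g w)"

lemma linear_extend_superset:
  assumes "finite A" "Poly_Mapping.keys x \<subseteq> A"
  shows "linear_extend g x = (\<Sum>w\<in>A. Poly_Mapping.lookup x w * g w)"
  unfolding linear_extend_def
  by (rule sum.mono_neutral_left) (use assms in \<open>auto simp: in_keys_iff\<close>)

lemma linear_extend_add: "linear_extend g (x + y) = linear_extend g x + linear_extend g y"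
proof -
  let ?A = "Poly_Mapping.keys x \<union> Poly_Mapping.keys y"
  have "Poly_Mapping.keys (x + y) \<subseteq> ?A"
    by (rule keys_add)
  then show ?thesis
    by (simp add: linear_extend_superset[where A = ?A] lookup_add distrib_right sum.distrib)
qed

lemma linear_extend_zero [simp]: "linear_extend g 0 = 0"
  by (simp add: linear_extend_def)

lemma linear_extend_uminus: "linear_extend g (- x) = - linear_extend g x"
  using linear_extend_add[of g x "- x"] by (simp add: eq_neg_iff_add_eq_0 add.commute)

lemma linear_extend_diff: "linear_extend g (x - y) = linear_extend g x - linear_extend g y"
  using linear_extend_add[of g x "- y"] by (simp add: linear_extend_uminus)

lemma linear_extend_single [simp]: "linear_extend g (Poly_Mapping.single w c) = c * g w"
  by (simp add: linear_extend_superset[where A = "{w}"])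

lemma linear_extend_sum: "linear_extend g (sum f A) = (\<Sum>i\<in>A. linear_extend g (f i))"
  by (induction A rule: infinite_finite_induct) (simp_all add: linear_extend_add)

lemma linear_extend_cong:
  "(\<And>w. w \<in> Poly_Mapping.keys x \<Longrightarrow> f w = g w) \<Longrightarrow> linear_extend f x = linear_extend g x"
  by (simp add: linear_extend_def)

lemma linear_extend_eq_zero:
  "(\<And>w. w \<in> Poly_Mapping.keys x \<Longrightarrow> g w = 0) \<Longrightarrow> linear_extend g x = 0"
  by (simp add: linear_extend_def)

lemma sum_single_lookup: "(\<Sum>w\<in>Poly_Mapping.keys x. Poly_Mapping.single w (Poly_Mapping.lookup x w)) = x"
  by (rule poly_mapping_eqI)
    (auto simp: lookup_sum lookup_single when_def in_keys_iff sum.delta)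

lemma linear_extend_mult:
  "linear_extend g (x * y) = linear_extend (\<lambda>u. linear_extend (\<lambda>w. g (u + w)) y) x"
proof -
  have "x * y = (\<Sum>u\<in>Poly_Mapping.keys x. \<Sum>w\<in>Poly_Mapping.keys y.
      Poly_Mapping.single (u + w) (Poly_Mapping.lookup x u * Poly_Mapping.lookup y w))"
    by (subst (1) sum_single_lookup[symmetric, of x], subst (1) sum_single_lookup[symmetric, of y])
      (simp add: sum_product mult_single)
  then show ?thesis
    by (simp add: linear_extend_sum linear_extend_def[of _ x] linear_extend_def[of _ y]
        sum_distrib_left mult.assoc)
qed

text \<open>In a product the right factor acts on a path first, whereas
  \<open>linear_extend_mult\<close> has the sum over the left factor outermost; the exchange repairs
  this.\<close>

lemma linear_extend_swap:
  "linear_extend (\<lambda>u. linear_extend (g u) y) x = linear_extend (\<lambda>w. linear_extend (\<lambda>u. g u w) x) y"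
  unfolding linear_extend_def
  by (simp add: sum_distrib_left mult.left_commute) (rule sum.swap)

context pre_digraph
begin

text \<open>
  A pair \<open>(p, v)\<close> stands for a path with edges \<open>p\<close> and range \<open>v\<close>; recording the range
  distinguishes the paths of length \<open>0\<close>.
\<close>

definition path_source :: "'b list \<times> 'a \<Rightarrow> 'a" where
  "path_source \<eta> = (case fst \<eta> of [] \<Rightarrow> snd \<eta> | e # _ \<Rightarrow> tail G e)"

definition is_path :: "'b list \<times> 'a \<Rightarrow> bool" where
  "is_path \<eta> \<longleftrightarrow> (\<exists>u. awalk u (fst \<eta>) (snd \<eta>))"

text \<open>\<open>None\<close> stands for zero. The path of length 0 at a vertex v is fixed by v
  but killed by every ghost, hence by the sum of the e e*: relation (iv) fails in this
  representation at every regular vertex.\<close>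

primrec letter_act :: "('a, 'b) generator \<Rightarrow> 'b list \<times> 'a \<Rightarrow> ('b list \<times> 'a) option" where
  "letter_act (Vertex u) \<eta> = (if path_source \<eta> = u then Some \<eta> else None)"
| "letter_act (Edge e) \<eta> = (if path_source \<eta> = head G e then Some (e # fst \<eta>, snd \<eta>) else None)"
| "letter_act (Ghost e) \<eta> =
    (case fst \<eta> of [] \<Rightarrow> None | f # p \<Rightarrow> if f = e then Some (p, snd \<eta>) else None)"

definition word_act :: "('a, 'b) generator word \<Rightarrow> 'b list \<times> 'a \<Rightarrow> ('b list \<times> 'a) option" where
  "word_act w \<eta> = foldr (\<lambda>x z. Option.bind z (letter_act x)) (letters w) (Some \<eta>)"

text \<open>
  The free algebra acts from the left on the space with basis the paths. The dual action, from the
  right on functions of paths, needs no finite support.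
\<close>

definition dual_act ::
  "('a, 'b, 'k::field) free_algebra \<Rightarrow> ('b list \<times> 'a \<Rightarrow> 'k) \<Rightarrow> 'b list \<times> 'a \<Rightarrow> 'k" where
  "dual_act x f \<eta> =
    linear_extend (\<lambda>w. case word_act w \<eta> of None \<Rightarrow> 0 | Some \<zeta> \<Rightarrow> f \<zeta>) x"

lemma path_source_simps [simp]:
  "path_source ([], v) = v" "path_source (e # p, v) = tail G e"
  by (simp_all add: path_source_def)

lemma word_act_Nil [simp]: "word_act (Word []) \<eta> = Some \<eta>"
  by (simp add: word_act_def)

lemma word_act_Cons [simp]:
  "word_act (Word (x # xs)) \<eta> = Option.bind (word_act (Word xs) \<eta>) (letter_act x)"
  by (simp add: word_act_def)

lemma word_act_append:
  "word_act (Word (xs @ ys)) \<eta> = Option.bind (word_act (Word ys) \<eta>) (word_act (Word xs))"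
proof (induction xs)
  case (Cons x xs)
  then show ?case
    by (cases "word_act (Word ys) \<eta>") simp_all
qed (cases "word_act (Word ys) \<eta>"; simp)

lemma word_act_add: "word_act (u + w) \<eta> = Option.bind (word_act w \<eta>) (word_act u)"
  using word_act_append[of "letters u" "letters w" \<eta>] by (simp add: plus_word_def)

lemma dual_act_add: "dual_act (x + y) f \<eta> = dual_act x f \<eta> + dual_act y f \<eta>"
  by (simp add: dual_act_def linear_extend_add)

lemma dual_act_zero [simp]: "dual_act 0 f \<eta> = 0"
  by (simp add: dual_act_def)

lemma dual_act_uminus: "dual_act (- x) f \<eta> = - dual_act x f \<eta>"
  by (simp add: dual_act_def linear_extend_uminus)

lemma dual_act_diff: "dual_act (x - y) f \<eta> = dual_act x f \<eta> - dual_act y f \<eta>"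
  by (simp add: dual_act_def linear_extend_diff)

lemma dual_act_single:
  "dual_act (Poly_Mapping.single w c) f \<eta> = c * (case word_act w \<eta> of None \<Rightarrow> 0 | Some \<zeta> \<Rightarrow> f \<zeta>)"
  by (simp add: dual_act_def)

text \<open>Transposition reverses the order of the factors. After the exchange of sums, a word w of
  \<open>y\<close> contributes the value of \<open>dual_act x f\<close> at the path w \<eta>, and
  zero if w kills \<eta>.\<close>

lemma dual_act_mult: "dual_act (x * y) f \<eta> = dual_act y (dual_act x f) \<eta>"
proof -
  have "dual_act (x * y) f \<eta> = linear_extend (\<lambda>w. linear_extend (\<lambda>u.
      case word_act (u + w) \<eta> of None \<Rightarrow> 0 | Some \<zeta> \<Rightarrow> f \<zeta>) x) y"
    unfolding dual_act_def linear_extend_mult by (rule linear_extend_swap)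
  also have "\<dots> = dual_act y (dual_act x f) \<eta>"
    unfolding dual_act_def
    by (rule linear_extend_cong) (auto simp: word_act_add intro!: linear_extend_eq_zero split: option.splits)
  finally show ?thesis .
qed

lemma dual_act_zero_fun: "(\<And>w \<zeta>. w \<in> Poly_Mapping.keys x \<Longrightarrow> word_act w \<eta> = Some \<zeta> \<Longrightarrow> f \<zeta> = 0) \<Longrightarrow> dual_act x f \<eta> = 0"
  unfolding dual_act_def by (rule linear_extend_eq_zero) (auto split: option.splits)

lemma dual_act_scale: "dual_act (scale c x) f \<eta> = c * dual_act x f \<eta>"
proof -
  have "scale c x = Poly_Mapping.single 0 c * x"
    by (simp add: scale_def)
  then have "dual_act (scale c x) f \<eta> =
      c * linear_extend (\<lambda>w. case word_act w \<eta> of None \<Rightarrow> 0 | Some \<zeta> \<Rightarrow> f \<zeta>) x"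
    by (simp add: dual_act_def linear_extend_mult)
  then show ?thesis
    by (simp add: dual_act_def)
qed

end

context wf_digraph
begin

lemma is_path_simps:
  "is_path ([], v) \<longleftrightarrow> v \<in> verts G"
  "is_path (e # p, v) \<longleftrightarrow> e \<in> arcs G \<and> is_path (p, v) \<and> path_source (p, v) = head G e"
proof -
  show "is_path ([], v) \<longleftrightarrow> v \<in> verts G"
    by (simp add: is_path_def awalk_Nil_iff)
  show "is_path (e # p, v) \<longleftrightarrow> e \<in> arcs G \<and> is_path (p, v) \<and> path_source (p, v) = head G e"
    by (cases p) (auto simp: is_path_def awalk_simps)
qed

lemma is_path_append:
  "is_path (p @ q, v) \<longleftrightarrow> is_path (p, path_source (q, v)) \<and> is_path (q, v)"
proof (induction p)
  case Nil
  have "is_path (q, v) \<Longrightarrow> path_source (q, v) \<in> verts G"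
    by (cases q) (auto simp: is_path_simps)
  then show ?case
    by (auto simp: is_path_simps)
next
  case (Cons e p)
  then show ?case
    by (cases p) (auto simp: is_path_simps)
qed

lemma letter_act_is_path:
  assumes "x \<in> generators G" "is_path \<eta>" "letter_act x \<eta> = Some \<zeta>"
  shows "is_path \<zeta> \<and> snd \<zeta> = snd \<eta>"
  using assms by (cases \<eta>; cases x) (auto simp: generators_def is_path_simps split: if_splits list.splits)

text \<open>Letters change a path only at its source end. Hence the paths with range in a given set
  span a submodule, and the elements killing it form a two-sided ideal.\<close>

lemma word_act_is_path:
  assumes "set (letters w) \<subseteq> generators G" "is_path \<eta>" "word_act w \<eta> = Some \<zeta>"
  shows "is_path \<zeta> \<and> snd \<zeta> = snd \<eta>"
proof -
  obtain xs where w: "w = Word xs"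
    by (cases w)
  have "set xs \<subseteq> generators G \<Longrightarrow> word_act (Word xs) \<eta> = Some \<zeta> \<Longrightarrow> is_path \<zeta> \<and> snd \<zeta> = snd \<eta>"
  proof (induction xs arbitrary: \<zeta>)
    case (Cons x xs)
    obtain \<xi> where \<xi>: "word_act (Word xs) \<eta> = Some \<xi>" "letter_act x \<xi> = Some \<zeta>"
      using Cons.prems(2) by (auto simp: bind_eq_Some_conv)
    then have "is_path \<xi> \<and> snd \<xi> = snd \<eta>"
      using Cons by simp
    then show ?case
      using letter_act_is_path[of x \<xi> \<zeta>] \<xi>(2) Cons.prems(1) by simp
  qed (use assms(2) in simp)
  then show ?thesis
    using assms w by simp
qed

text \<open>The star reverses a path, so the rightmost ghost, which acts first, strips the first
  edge of \<open>q\<close>.\<close>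

lemma word_act_ghosts:
  "word_act (Word (map Ghost (rev q))) \<eta> = Some \<zeta> \<longleftrightarrow> fst \<eta> = q @ fst \<zeta> \<and> snd \<zeta> = snd \<eta>"
proof (induction q arbitrary: \<eta>)
  case (Cons e q)
  show ?case
    by (cases \<eta>; cases "fst \<eta>") (auto simp: word_act_append Cons.IH)
qed (cases \<eta>; cases \<zeta>; auto)

lemma word_act_edges:
  assumes "is_path (p, path_source \<eta>)"
  shows "word_act (Word (map Edge p)) \<eta> = Some (p @ fst \<eta>, snd \<eta>)"
  using assms
proof (induction p)
  case (Cons e p)
  then show ?case
    by (cases p; cases \<eta>) (auto simp: is_path_simps)
qed simp

end

text \<open>The monomial \<open>p q\<^sup>*\<close>, for paths \<open>p\<close> and \<open>q\<close> with range \<open>v\<close>.\<close>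

definition normal_word :: "'b list \<Rightarrow> 'a \<Rightarrow> 'b list \<Rightarrow> ('a, 'b) generator word" where
  "normal_word p v q = Word (map Edge p @ Vertex v # map Ghost (rev q))"

text \<open>The letter \<open>Vertex v\<close> is kept even where an adjacent edge or ghost would
  absorb it: it separates the two lists and records the range when both are empty.\<close>

lemma normal_word_inject:
  "normal_word p v q = normal_word p' v' q' \<longleftrightarrow> p = p' \<and> v = v' \<and> q = q'"
proof -
  have "p = p' \<and> v = v' \<and> map Ghost (rev q) = (map Ghost (rev q') :: ('a, 'b) generator list)"
    if "map Edge p @ Vertex v # map Ghost (rev q) =
      (map Edge p' @ Vertex v' # map Ghost (rev q') :: ('a, 'b) generator list)"
    using that
  proof (induction p arbitrary: p')
    case Nil
    then show ?case by (cases p') auto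
  next
    case (Cons e p)
    then show ?case by (cases p') auto
  qed
  moreover have "inj (Ghost :: 'b \<Rightarrow> ('a, 'b) generator)"
    by (auto intro: injI)
  ultimately show ?thesis
    by (auto simp: normal_word_def inj_map_eq_map)
qed

context wf_digraph
begin

lemma word_act_normal_word:
  assumes "is_path (p, v)"
  shows "word_act (normal_word p v q) \<eta> = Some \<zeta> \<longleftrightarrow>
    (\<exists>b. \<eta> = (q @ b, snd \<eta>) \<and> path_source (b, snd \<eta>) = v \<and> \<zeta> = (p @ b, snd \<eta>))"
proof -
  have *: "word_act (normal_word p v q) \<eta> = Option.bind (word_act (Word (map Ghost (rev q))) \<eta>)
    (\<lambda>\<xi>. Option.bind (letter_act (Vertex v) \<xi>) (word_act (Word (map Edge p))))"
    unfolding normal_word_def by (subst word_act_append) (simp add: word_act_append)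
  show ?thesis
  proof
    assume "word_act (normal_word p v q) \<eta> = Some \<zeta>"
    then obtain \<xi> where \<xi>: "word_act (Word (map Ghost (rev q))) \<eta> = Some \<xi>" "path_source \<xi> = v"
      "word_act (Word (map Edge p)) \<xi> = Some \<zeta>"
      unfolding * by (auto simp: bind_eq_Some_conv split: if_splits)
    moreover have "word_act (Word (map Edge p)) \<xi> = Some (p @ fst \<xi>, snd \<xi>)"
      using word_act_edges \<xi>(2) assms by blast
    ultimately show "\<exists>b. \<eta> = (q @ b, snd \<eta>) \<and> path_source (b, snd \<eta>) = v \<and> \<zeta> = (p @ b, snd \<eta>)"
      by (cases \<eta>; cases \<xi>) (auto simp: word_act_ghosts)
  next
    assume "\<exists>b. \<eta> = (q @ b, snd \<eta>) \<and> path_source (b, snd \<eta>) = v \<and> \<zeta> = (p @ b, snd \<eta>)"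
    then obtain b where b: "\<eta> = (q @ b, snd \<eta>)" "path_source (b, snd \<eta>) = v" "\<zeta> = (p @ b, snd \<eta>)"
      by blast
    have "word_act (Word (map Ghost (rev q))) \<eta> = Some (b, snd \<eta>)"
      using b(1) by (simp add: word_act_ghosts) (metis fst_conv)
    moreover have "word_act (Word (map Edge p)) (b, snd \<eta>) = Some (p @ b, snd \<eta>)"
      using word_act_edges[of p "(b, snd \<eta>)"] b(2) assms by simp
    ultimately show "word_act (normal_word p v q) \<eta> = Some \<zeta>"
      unfolding * using b by simp
  qed
qed

end

section \<open>Normal forms in the Leavitt path algebra\<close>

lemma free_nonunital_algebra_simps [simp]:
  "mult (free_nonunital_algebra K G) = (*)" "add (free_nonunital_algebra K G) = (+)"
  "zero (free_nonunital_algebra K G) = 0"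
  by (simp_all add: free_nonunital_algebra_def)

lemma carrier_free_nonunital_algebra:
  "p \<in> carrier (free_nonunital_algebra K G) \<longleftrightarrow>
    (\<forall>w\<in>Poly_Mapping.keys p. letters w \<noteq> [] \<and> set (letters w) \<subseteq> generators G)"
  by (simp add: free_nonunital_algebra_def)

lemma single_in_carrier:
  "letters w \<noteq> [] \<Longrightarrow> set (letters w) \<subseteq> generators G \<Longrightarrow>
    Poly_Mapping.single w c \<in> carrier (free_nonunital_algebra K G)"
  by (simp add: carrier_free_nonunital_algebra)

lemma carrier_free_add:
  "x \<in> carrier (free_nonunital_algebra K G) \<Longrightarrow> y \<in> carrier (free_nonunital_algebra K G) \<Longrightarrow>
    x + y \<in> carrier (free_nonunital_algebra K G)"
  using keys_add[of x y] by (auto simp: carrier_free_nonunital_algebra)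

text \<open>One factor without constant term is enough. This covers \<open>scale\<close>, whose
  first factor is a constant.\<close>

lemma carrier_free_mult_word:
  assumes "\<And>w. w \<in> Poly_Mapping.keys x \<Longrightarrow> set (letters w) \<subseteq> generators G"
    and "\<And>w. w \<in> Poly_Mapping.keys y \<Longrightarrow> set (letters w) \<subseteq> generators G"
    and "x \<in> carrier (free_nonunital_algebra K G) \<or> y \<in> carrier (free_nonunital_algebra K G)"
  shows "x * y \<in> carrier (free_nonunital_algebra K G)"
  unfolding carrier_free_nonunital_algebra
proof
  fix w
  assume "w \<in> Poly_Mapping.keys (x * y)"
  then obtain a b where "w = a + b" "a \<in> Poly_Mapping.keys x" "b \<in> Poly_Mapping.keys y"
    using keys_mult[of x y] by blast
  then show "letters w \<noteq> [] \<and> set (letters w) \<subseteq> generators G"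
    using assms by (auto simp: carrier_free_nonunital_algebra plus_word_def)
qed

lemma carrier_free_mult:
  "x \<in> carrier (free_nonunital_algebra K G) \<Longrightarrow> y \<in> carrier (free_nonunital_algebra K G) \<Longrightarrow>
    x * y \<in> carrier (free_nonunital_algebra K G)"
  by (rule carrier_free_mult_word) (auto simp: carrier_free_nonunital_algebra)

lemma carrier_free_zero: "0 \<in> carrier (free_nonunital_algebra K G)"
  by (simp add: carrier_free_nonunital_algebra)

lemma carrier_free_uminus:
  "x \<in> carrier (free_nonunital_algebra K G) \<Longrightarrow> - x \<in> carrier (free_nonunital_algebra K G)"
  by (simp add: carrier_free_nonunital_algebra in_keys_iff)

lemma carrier_free_diff:
  "x \<in> carrier (free_nonunital_algebra K G) \<Longrightarrow> y \<in> carrier (free_nonunital_algebra K G) \<Longrightarrow>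
    x - y \<in> carrier (free_nonunital_algebra K G)"
  using carrier_free_add[of x K G "- y"] carrier_free_uminus[of y K G] by simp

lemma carrier_free_scale:
  "x \<in> carrier (free_nonunital_algebra K G) \<Longrightarrow> scale c x \<in> carrier (free_nonunital_algebra K G)"
  unfolding scale_def
  by (rule carrier_free_mult_word) (auto simp: carrier_free_nonunital_algebra zero_word_def split: if_splits)

interpretation free: nonunital_ring "free_nonunital_algebra K G" for K :: "'k::field itself" and G
proof (intro nonunital_ring.intro nonunital_ring_axioms.intro abelian_groupI)
  fix x :: "('a, 'b, 'k) free_algebra"
  assume "x \<in> carrier (free_nonunital_algebra K G)"
  then show "\<exists>y\<in>carrier (free_nonunital_algebra K G).
      y \<oplus>\<^bsub>free_nonunital_algebra K G\<^esub> x = \<zero>\<^bsub>free_nonunital_algebra K G\<^esub>"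
    by (intro bexI[of _ "- x"]) (simp_all add: carrier_free_uminus)
qed (simp_all add: carrier_free_add carrier_free_mult carrier_free_zero algebra_simps)

lemma free_a_inv:
  "x \<in> carrier (free_nonunital_algebra K G) \<Longrightarrow> a_inv (free_nonunital_algebra K G) x = - x"
  by (rule free.minus_equality) (simp_all add: carrier_free_uminus)

lemma free_a_minus:
  "\<lbrakk>x \<in> carrier (free_nonunital_algebra K G); y \<in> carrier (free_nonunital_algebra K G)\<rbrakk> \<Longrightarrow>
    a_minus (free_nonunital_algebra K G) x y = x - y"
  by (simp add: a_minus_def free_a_inv)

definition algebra_ideal ::
  "'k::field itself \<Rightarrow> ('v, 'e) pre_digraph \<Rightarrow> ('v, 'e, 'k) free_algebra set \<Rightarrow> bool" where
  "algebra_ideal K G I \<longleftrightarrow>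
    two_sided_ideal (free_nonunital_algebra K G) I \<and> (\<forall>c. \<forall>x\<in>I. scale c x \<in> I)"

lemma algebra_ideal_iff:
  "algebra_ideal K G I \<longleftrightarrow> I \<subseteq> carrier (free_nonunital_algebra K G) \<and> 0 \<in> I \<and>
    (\<forall>x\<in>I. \<forall>y\<in>I. x + y \<in> I) \<and> (\<forall>x\<in>I. - x \<in> I) \<and>
    (\<forall>a\<in>carrier (free_nonunital_algebra K G). \<forall>x\<in>I. a * x \<in> I \<and> x * a \<in> I) \<and>
    (\<forall>c. \<forall>x\<in>I. scale c x \<in> I)"
proof (cases "I \<subseteq> carrier (free_nonunital_algebra K G)")
  case True
  then have "a_inv (free_nonunital_algebra K G) x = - x" if "x \<in> I" for x
    using that free_a_inv by blast
  then show ?thesis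
    unfolding algebra_ideal_def two_sided_ideal_def left_ideal_def free.additive_subgroup_iff
    by auto
qed (auto simp: algebra_ideal_def two_sided_ideal_def left_ideal_def free.additive_subgroup_iff)

text \<open>With relation (iv) vacuous, normal forms need no choice of a special edge at each
  regular vertex.\<close>

locale leavitt_no_regular = wf_digraph G for G :: "('v, 'e) pre_digraph" (structure) +
  fixes K :: "'k::field itself"
  assumes no_regular: "\<not> regular_vertex G v"
begin

abbreviation F where "F \<equiv> free_nonunital_algebra K G"
abbreviation J where "J \<equiv> leavitt_ideal K G"

lemma gen_in_carrier: "x \<in> generators G \<Longrightarrow> gen x \<in> carrier F"
  unfolding gen_def by (rule single_in_carrier) auto

lemma generators_intros [simp, intro]:
  "v \<in> verts G \<Longrightarrow> Vertex v \<in> generators G"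
  "e \<in> arcs G \<Longrightarrow> Edge e \<in> generators G" "e \<in> arcs G \<Longrightarrow> Ghost e \<in> generators G"
  by (auto simp: generators_def)

lemma relators_in_carrier: "leavitt_relators K G \<subseteq> carrier F"
  unfolding leavitt_relators_def using no_regular
  by (auto intro!: carrier_free_diff carrier_free_mult gen_in_carrier carrier_free_zero)

lemma algebra_ideal_carrier: "algebra_ideal K G (carrier F)"
  by (auto simp: algebra_ideal_iff intro: carrier_free_add carrier_free_mult carrier_free_zero
      carrier_free_uminus carrier_free_scale)

lemma leavitt_ideal_least: "algebra_ideal K G I \<Longrightarrow> leavitt_relators K G \<subseteq> I \<Longrightarrow> J \<subseteq> I"
  by (auto simp: leavitt_ideal_def algebra_ideal_def)

lemma relators_in_leavitt_ideal: "leavitt_relators K G \<subseteq> J"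
  by (auto simp: leavitt_ideal_def)

lemma algebra_ideal_leavitt_ideal: "algebra_ideal K G J"
proof -
  have eq: "J = \<Inter>{I. algebra_ideal K G I \<and> leavitt_relators K G \<subseteq> I}"
    by (simp add: leavitt_ideal_def algebra_ideal_def conj_assoc)
  have "J \<subseteq> carrier F"
    using leavitt_ideal_least algebra_ideal_carrier relators_in_carrier by blast
  then show ?thesis
    unfolding algebra_ideal_iff unfolding eq
    by (intro conjI ballI allI) (auto simp: algebra_ideal_iff)
qed

lemma
  shows J_carrier: "x \<in> J \<Longrightarrow> x \<in> carrier F" and J_zero: "0 \<in> J"
    and J_add: "\<lbrakk>x \<in> J; y \<in> J\<rbrakk> \<Longrightarrow> x + y \<in> J" and J_uminus: "x \<in> J \<Longrightarrow> - x \<in> J"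
    and J_mult_left: "\<lbrakk>a \<in> carrier F; x \<in> J\<rbrakk> \<Longrightarrow> a * x \<in> J"
    and J_mult_right: "\<lbrakk>a \<in> carrier F; x \<in> J\<rbrakk> \<Longrightarrow> x * a \<in> J"
    and J_scale: "x \<in> J \<Longrightarrow> scale c x \<in> J"
  using algebra_ideal_leavitt_ideal unfolding algebra_ideal_iff by blast+

text \<open>Linear functionals separate points, so letting \<open>f\<close> vary says exactly that x
  kills the path \<eta>; the vector x \<eta> itself need not be formed.\<close>

definition annihilator :: "'v set \<Rightarrow> ('v, 'e, 'k) free_algebra set" where
  "annihilator S = {x \<in> carrier F. \<forall>f \<eta>. is_path \<eta> \<longrightarrow> snd \<eta> \<in> S \<longrightarrow> dual_act x f \<eta> = 0}"

lemma dual_act_annihilator: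
  assumes "x \<in> annihilator S" "is_path \<eta>" "snd \<eta> \<in> S"
  shows "dual_act x f \<eta> = 0"
  using assms unfolding annihilator_def by blast

lemma dual_act_outside:
  assumes "x \<in> carrier F" "is_path \<eta>" "\<And>\<zeta>. is_path \<zeta> \<Longrightarrow> snd \<zeta> = snd \<eta> \<Longrightarrow> f \<zeta> = 0"
  shows "dual_act x f \<eta> = 0"
proof (rule dual_act_zero_fun)
  fix w \<zeta>
  assume w: "w \<in> Poly_Mapping.keys x" and \<zeta>: "word_act w \<eta> = Some \<zeta>"
  have "set (letters w) \<subseteq> generators G"
    using w assms(1) by (simp add: carrier_free_nonunital_algebra)
  then show "f \<zeta> = 0"
    using word_act_is_path[OF _ assms(2) \<zeta>] assms(3) by blast
qed

lemma algebra_ideal_annihilator: "algebra_ideal K G (annihilator S)"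
proof -
  have "a * x \<in> annihilator S \<and> x * a \<in> annihilator S"
    if "a \<in> carrier F" "x \<in> annihilator S" for a x
  proof -
    \<comment> \<open>The case of \<open>x * a\<close>: the action of \<open>a\<close> preserves
      ranges, and \<open>dual_act x f\<close> vanishes on every path with such a range. For
      \<open>a * x\<close> the vanishing is immediate.\<close>
    have "dual_act a (dual_act x f) \<eta> = 0" if "is_path \<eta>" "snd \<eta> \<in> S" for f \<eta>
      by (rule dual_act_outside)
        (use \<open>a \<in> carrier F\<close> \<open>x \<in> annihilator S\<close> that in \<open>auto intro: dual_act_annihilator\<close>)
    then show ?thesis
      using that by (auto simp: annihilator_def dual_act_mult simp del: split_paired_All intro: carrier_free_mult)
  qed
  then show ?thesis
    unfolding algebra_ideal_iff
    by (auto simp: annihilator_def dual_act_add dual_act_uminus dual_act_scale simp del: split_paired_All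
        intro: carrier_free_add carrier_free_zero carrier_free_uminus carrier_free_scale)
qed

lemma gen_mult: "gen x * gen y = Poly_Mapping.single (Word [x, y]) 1"
  by (simp add: gen_def mult_single plus_word_def)

text \<open>Checked on empty and on nonempty paths. The relators kill every path, so
  \<open>S\<close> is arbitrary; for \<open>S = UNIV\<close> this makes the action pass to the
  quotient.\<close>

lemma relators_annihilator: "leavitt_relators K G \<subseteq> annihilator S"
proof -
  have "dual_act x f \<eta> = 0" if "x \<in> leavitt_relators K G" "is_path \<eta>" for x f \<eta>
  proof (cases \<eta>)
    case (Pair p v)
    show ?thesis
      using that Pair unfolding leavitt_relators_def
      by (cases p)
        (auto simp: no_regular dual_act_diff gen_def mult_single plus_word_def dual_act_single is_path_simps
          split: if_splits)
  qed
  then show ?thesis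
    using relators_in_carrier by (auto simp: annihilator_def simp del: split_paired_All)
qed

lemma leavitt_ideal_annihilator: "J \<subseteq> annihilator S"
  by (rule leavitt_ideal_least[OF algebra_ideal_annihilator relators_annihilator])

section \<open>Reduction of words modulo the relations\<close>

definition word_null :: "('v, 'e) generator list \<Rightarrow> bool" where
  "word_null xs \<longleftrightarrow> Poly_Mapping.single (Word xs) 1 \<in> J"

text \<open>Each relation that remains turns a word into another word or into zero, never into a
  proper sum. So congruence and nullity of single words suffice until coefficients return in
  \<open>normal_form\<close>.\<close>

definition word_equiv :: "('v, 'e) generator list \<Rightarrow> ('v, 'e) generator list \<Rightarrow> bool" where
  "word_equiv xs ys \<longleftrightarrow> Poly_Mapping.single (Word xs) 1 - Poly_Mapping.single (Word ys) 1 \<in> J"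

lemma word_equiv_refl: "word_equiv xs xs"
  by (simp add: word_equiv_def J_zero)

lemma word_equiv_sym: "word_equiv xs ys \<Longrightarrow> word_equiv ys xs"
  using J_uminus by (fastforce simp: word_equiv_def)

lemma word_equiv_trans [trans]: "word_equiv xs ys \<Longrightarrow> word_equiv ys zs \<Longrightarrow> word_equiv xs zs"
  using J_add by (fastforce simp: word_equiv_def)

lemma word_equiv_null [trans]: "word_equiv xs ys \<Longrightarrow> word_null ys \<Longrightarrow> word_null xs"
  using J_add by (fastforce simp: word_equiv_def word_null_def)

text \<open>An empty context is the unit of the ambient algebra, which lies outside the carrier, so
  it is not covered by closure of the ideal under multiplication.\<close>

lemma J_context:
  assumes "x \<in> J" "set xs \<subseteq> generators G" "set ys \<subseteq> generators G"
  shows "Poly_Mapping.single (Word xs) 1 * x * Poly_Mapping.single (Word ys) 1 \<in> J"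
proof -
  have one: "Poly_Mapping.single (Word []) 1 = (1 :: ('v, 'e, 'k) free_algebra)"
    by (metis single_one zero_word_def)
  have "Poly_Mapping.single (Word xs) 1 * x \<in> J"
    using assms by (cases "xs = []") (auto simp: one intro!: J_mult_left single_in_carrier)
  then show ?thesis
    using assms by (cases "ys = []") (auto simp: one intro!: J_mult_right single_in_carrier)
qed

lemma word_equiv_context:
  assumes "word_equiv us ws" "set xs \<subseteq> generators G" "set ys \<subseteq> generators G"
  shows "word_equiv (xs @ us @ ys) (xs @ ws @ ys)"
  using J_context[OF assms(1)[unfolded word_equiv_def] assms(2,3)]
  by (simp add: word_equiv_def right_diff_distrib left_diff_distrib mult_single plus_word_def)

lemma word_null_context:
  assumes "word_null us" "set xs \<subseteq> generators G" "set ys \<subseteq> generators G"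
  shows "word_null (xs @ us @ ys)"
  using J_context[OF assms(1)[unfolded word_null_def] assms(2,3)]
  by (simp add: word_null_def mult_single plus_word_def)

lemma word_relations:
  "v \<in> verts G \<Longrightarrow> word_equiv [Vertex v, Vertex v] [Vertex v]"
  "\<lbrakk>v \<in> verts G; w \<in> verts G; v \<noteq> w\<rbrakk> \<Longrightarrow> word_null [Vertex v, Vertex w]"
  "e \<in> arcs G \<Longrightarrow> word_equiv [Vertex (tail G e), Edge e] [Edge e]"
  "e \<in> arcs G \<Longrightarrow> word_equiv [Edge e, Vertex (head G e)] [Edge e]"
  "e \<in> arcs G \<Longrightarrow> word_equiv [Vertex (head G e), Ghost e] [Ghost e]"
  "e \<in> arcs G \<Longrightarrow> word_equiv [Ghost e, Vertex (tail G e)] [Ghost e]"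
  "e \<in> arcs G \<Longrightarrow> word_equiv [Ghost e, Edge e] [Vertex (head G e)]"
  "\<lbrakk>e \<in> arcs G; f \<in> arcs G; e \<noteq> f\<rbrakk> \<Longrightarrow> word_null [Ghost e, Edge f]"
proof -
  have mem: "x \<in> J" if "x \<in> leavitt_relators K G" for x
    using relators_in_leavitt_ideal that by blast
  have vertices: "gen (Vertex v) * gen (Vertex w) - (if v = w then gen (Vertex v) else 0) \<in> J"
    if "v \<in> verts G" "w \<in> verts G" for v w
    by (rule mem) (use that in \<open>unfold leavitt_relators_def, blast\<close>)
  have ghost_edge: "gen (Ghost e) * gen (Edge f) - (if e = f then gen (Vertex (head G e)) else 0) \<in> J"
    if "e \<in> arcs G" "f \<in> arcs G" for e f
    by (rule mem) (use that in \<open>unfold leavitt_relators_def, blast\<close>)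
  note unf = word_equiv_def word_null_def gen_mult[symmetric] gen_def[symmetric]
  show "v \<in> verts G \<Longrightarrow> word_equiv [Vertex v, Vertex v] [Vertex v]"
    unfolding unf by (rule mem) (auto simp: leavitt_relators_def)
  show "\<lbrakk>v \<in> verts G; w \<in> verts G; v \<noteq> w\<rbrakk> \<Longrightarrow> word_null [Vertex v, Vertex w]"
    unfolding unf using vertices[of v w] by simp
  show "e \<in> arcs G \<Longrightarrow> word_equiv [Vertex (tail G e), Edge e] [Edge e]"
    unfolding unf by (rule mem) (auto simp: leavitt_relators_def)
  show "e \<in> arcs G \<Longrightarrow> word_equiv [Edge e, Vertex (head G e)] [Edge e]"
    unfolding unf by (rule mem) (auto simp: leavitt_relators_def)
  show "e \<in> arcs G \<Longrightarrow> word_equiv [Vertex (head G e), Ghost e] [Ghost e]"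
    unfolding unf by (rule mem) (auto simp: leavitt_relators_def)
  show "e \<in> arcs G \<Longrightarrow> word_equiv [Ghost e, Vertex (tail G e)] [Ghost e]"
    unfolding unf by (rule mem) (auto simp: leavitt_relators_def)
  show "e \<in> arcs G \<Longrightarrow> word_equiv [Ghost e, Edge e] [Vertex (head G e)]"
    unfolding unf by (rule mem) (auto simp: leavitt_relators_def)
  show "\<lbrakk>e \<in> arcs G; f \<in> arcs G; e \<noteq> f\<rbrakk> \<Longrightarrow> word_null [Ghost e, Edge f]"
    unfolding unf using ghost_edge[of e f] by simp
qed

text \<open>An edge or ghost is first expanded by the vertex it absorbs at the junction; two
  distinct vertices then meet, and these are orthogonal.\<close>

lemma word_null_products:
  "\<lbrakk>u \<in> verts G; e \<in> arcs G; u \<noteq> tail G e\<rbrakk> \<Longrightarrow> word_null [Vertex u, Edge e]"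
  "\<lbrakk>u \<in> verts G; e \<in> arcs G; u \<noteq> head G e\<rbrakk> \<Longrightarrow> word_null [Edge e, Vertex u]"
  "\<lbrakk>e \<in> arcs G; f \<in> arcs G; head G e \<noteq> tail G f\<rbrakk> \<Longrightarrow> word_null [Edge e, Edge f]"
  "\<lbrakk>u \<in> verts G; e \<in> arcs G; u \<noteq> tail G e\<rbrakk> \<Longrightarrow> word_null [Ghost e, Vertex u]"
proof -
  show 1: "word_null [Vertex u, Edge e]" if "u \<in> verts G" "e \<in> arcs G" "u \<noteq> tail G e" for u e
    using word_equiv_context[OF word_equiv_sym[OF word_relations(3)[OF that(2)]], of "[Vertex u]" "[]"]
      word_null_context[OF word_relations(2)[OF that(1) _ that(3)], of "[]" "[Edge e]"] that
    by (auto intro: word_equiv_null)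
  show "word_null [Edge e, Vertex u]" if "u \<in> verts G" "e \<in> arcs G" "u \<noteq> head G e"
    using word_equiv_context[OF word_equiv_sym[OF word_relations(4)[OF that(2)]], of "[]" "[Vertex u]"]
      word_null_context[OF word_relations(2)[OF _ that(1) that(3)[symmetric]], of "[Edge e]" "[]"] that
    by (auto intro: word_equiv_null)
  show "word_null [Edge e, Edge f]" if "e \<in> arcs G" "f \<in> arcs G" "head G e \<noteq> tail G f"
    using word_equiv_context[OF word_equiv_sym[OF word_relations(4)[OF that(1)]], of "[]" "[Edge f]"]
      word_null_context[OF 1[OF _ that(2,3)], of "[Edge e]" "[]"] that
    by (auto intro: word_equiv_null)
  show "word_null [Ghost e, Vertex u]" if "u \<in> verts G" "e \<in> arcs G" "u \<noteq> tail G e"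
    using word_equiv_context[OF word_equiv_sym[OF word_relations(6)[OF that(2)]], of "[]" "[Vertex u]"]
      word_null_context[OF word_relations(2)[OF _ that(1) that(3)[symmetric]], of "[Ghost e]" "[]"] that
    by (auto intro: word_equiv_null)
qed

definition reducible :: "('v, 'e) generator list \<Rightarrow> bool" where
  "reducible xs \<longleftrightarrow> word_null xs \<or>
    (\<exists>p v q. is_path (p, v) \<and> is_path (q, v) \<and> word_equiv xs (letters (normal_word p v q)))"

lemma reducible_normal_word:
  "is_path (p, v) \<Longrightarrow> is_path (q, v) \<Longrightarrow> reducible (letters (normal_word p v q))"
  unfolding reducible_def using word_equiv_refl by blast

lemma reducible_equiv: "word_equiv xs ys \<Longrightarrow> reducible ys \<Longrightarrow> reducible xs"
  unfolding reducible_def using word_equiv_trans word_equiv_null by blast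

lemma reducible_null: "word_null us \<Longrightarrow> set xs \<subseteq> generators G \<Longrightarrow> reducible (us @ xs)"
  unfolding reducible_def using word_null_context[of us "[]" xs] by simp

lemma is_path_in_arcs: "is_path (p, v) \<Longrightarrow> set p \<subseteq> arcs G \<and> v \<in> verts G"
  by (induction p) (auto simp: is_path_simps)

lemma letters_normal_word:
  assumes "is_path (p, v)" "is_path (q, v)"
  shows "set (letters (normal_word p v q)) \<subseteq> generators G"
  using is_path_in_arcs[OF assms(1)] is_path_in_arcs[OF assms(2)]
  by (auto simp: normal_word_def)

lemma normal_word_not_Nil: "letters (normal_word p v q) \<noteq> []"
  by (simp add: normal_word_def)

lemma reducible_Vertex:
  assumes "u \<in> verts G" "is_path (p, v)" "is_path (q, v)"
  shows "reducible (Vertex u # letters (normal_word p v q))"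
proof (cases p)
  case Nil
  let ?qs = "map Ghost (rev q)"
  have qs: "set ?qs \<subseteq> generators G" and v: "v \<in> verts G"
    using assms is_path_in_arcs[OF assms(3)] by auto
  show ?thesis
  proof (cases "u = v")
    case True
    have "word_equiv (Vertex u # letters (normal_word p v q)) (letters (normal_word p v q))"
      using word_equiv_context[OF word_relations(1)[OF v], of "[]" ?qs] qs True Nil
      by (simp add: normal_word_def)
    then show ?thesis
      using reducible_equiv reducible_normal_word assms by blast
  next
    case False
    then show ?thesis
      using reducible_null[OF word_relations(2)[OF assms(1) v False] qs] Nil
      by (simp add: normal_word_def)
  qed
next
  case (Cons e p')
  let ?r = "map Edge p' @ Vertex v # map Ghost (rev q)"
  have e: "e \<in> arcs G"
    using assms(2) Cons by (simp add: is_path_simps)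
  have r: "set ?r \<subseteq> generators G"
    using letters_normal_word[OF assms(2,3)] Cons by (simp add: normal_word_def)
  show ?thesis
  proof (cases "u = tail G e")
    case True
    have "word_equiv (Vertex u # letters (normal_word p v q)) (letters (normal_word p v q))"
      using word_equiv_context[OF word_relations(3)[OF e], of "[]" ?r] r True Cons
      by (simp add: normal_word_def)
    then show ?thesis
      using reducible_equiv reducible_normal_word assms by blast
  next
    case False
    then show ?thesis
      using reducible_null[OF word_null_products(1)[OF assms(1) e False] r] Cons
      by (simp add: normal_word_def)
  qed
qed

lemma reducible_Edge:
  assumes e: "e \<in> arcs G" and "is_path (p, v)" "is_path (q, v)"
  shows "reducible (Edge e # letters (normal_word p v q))"
proof (cases "path_source (p, v) = head G e")
  case True
  then have "is_path (e # p, v)"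
    using assms by (simp add: is_path_simps)
  from reducible_normal_word[OF this assms(3)] show ?thesis
    by (simp add: normal_word_def)
next
  case False
  have r: "set (letters (normal_word p v q)) \<subseteq> generators G"
    by (rule letters_normal_word[OF assms(2,3)])
  show ?thesis
  proof (cases p)
    case Nil
    then have "word_null [Edge e, Vertex v]"
      using False assms by (intro word_null_products) (auto simp: is_path_simps)
    then show ?thesis
      using reducible_null[of "[Edge e, Vertex v]" "map Ghost (rev q)"] r Nil
      by (simp add: normal_word_def)
  next
    case (Cons f p')
    then have "word_null [Edge e, Edge f]"
      using False assms by (intro word_null_products) (auto simp: is_path_simps)
    then show ?thesis
      using reducible_null[of "[Edge e, Edge f]" "map Edge p' @ Vertex v # map Ghost (rev q)"] r Cons
      by (simp add: normal_word_def)
  qed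
qed

lemma reducible_Ghost:
  assumes e: "e \<in> arcs G" and "is_path (p, v)" "is_path (q, v)"
  shows "reducible (Ghost e # letters (normal_word p v q))"
proof (cases p)
  case Nil
  let ?qs = "map Ghost (rev q)"
  have qs: "set ?qs \<subseteq> generators G" and v: "v \<in> verts G"
    using assms is_path_in_arcs[OF assms(3)] by auto
  show ?thesis
  proof (cases "v = tail G e")
    case True
    \<comment> \<open>Here the product e* v q* is the star of the longer path q e, and the range
      changes from v to \<open>head G e\<close>.\<close>
    have "word_equiv (Ghost e # Vertex v # ?qs) (Ghost e # ?qs)"
      using word_equiv_context[OF word_relations(6)[OF e], of "[]" ?qs] qs True by simp
    moreover have "word_equiv (Ghost e # ?qs) (Vertex (head G e) # Ghost e # ?qs)"
      using word_equiv_context[OF word_equiv_sym[OF word_relations(5)[OF e]], of "[]" ?qs] qs by simp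
    ultimately have "word_equiv (Ghost e # letters (normal_word p v q))
        (letters (normal_word [] (head G e) (q @ [e])))"
      using Nil by (auto simp: normal_word_def intro: word_equiv_trans)
    moreover have "reducible (letters (normal_word [] (head G e) (q @ [e])))"
      using assms(3) e True by (intro reducible_normal_word) (simp_all add: is_path_append is_path_simps)
    ultimately show ?thesis
      by (rule reducible_equiv)
  next
    case False
    then show ?thesis
      using reducible_null[OF word_null_products(4)[OF v e False] qs] Nil
      by (simp add: normal_word_def)
  qed
next
  case (Cons f p')
  let ?r = "map Edge p' @ Vertex v # map Ghost (rev q)"
  have f: "f \<in> arcs G" "is_path (p', v)"
    using assms(2) Cons by (simp_all add: is_path_simps)
  have r: "set ?r \<subseteq> generators G"
    using letters_normal_word[OF assms(2,3)] Cons by (simp add: normal_word_def)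
  show ?thesis
  proof (cases "e = f")
    case True
    have "word_equiv (Ghost e # letters (normal_word p v q)) (Vertex (head G e) # ?r)"
      using word_equiv_context[OF word_relations(7)[OF e], of "[]" ?r] r True Cons
      by (simp add: normal_word_def)
    moreover have "reducible (Vertex (head G e) # ?r)"
      using reducible_Vertex[of "head G e" p' v q] e f assms(3) by (simp add: normal_word_def)
    ultimately show ?thesis
      by (rule reducible_equiv)
  next
    case False
    then show ?thesis
      using reducible_null[OF word_relations(8)[OF e f(1) False] r] Cons
      by (simp add: normal_word_def)
  qed
qed

text \<open>Words grow to the left, so it is enough to reduce the product of one generator with a
  normal word; a star factor is never multiplied from the right.\<close>

lemma reducible_all:
  assumes "xs \<noteq> []" "set xs \<subseteq> generators G"
  shows "reducible xs"
  using assms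
proof (induction xs)
  case (Cons x xs)
  have x: "x \<in> generators G"
    using Cons.prems by simp
  have step: "reducible (x # letters (normal_word p v q))" if "is_path (p, v)" "is_path (q, v)" for p v q
    using x that reducible_Vertex reducible_Edge reducible_Ghost by (auto simp: generators_def)
  show ?case
  proof (cases "xs = []")
    case True
    show ?thesis
    proof (cases x)
      case (Vertex v)
      then show ?thesis
        using True x reducible_normal_word[of "[]" v "[]"]
        by (auto simp: normal_word_def is_path_simps generators_def)
    next
      case (Edge e)
      then have e: "e \<in> arcs G"
        using x by (auto simp: generators_def)
      have "reducible [Edge e, Vertex (head G e)]"
        using reducible_normal_word[of "[e]" "head G e" "[]"] e
        by (simp add: normal_word_def is_path_simps)
      then show ?thesis
        using word_equiv_sym[OF word_relations(4)[OF e]] True Edge reducible_equiv by simp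
    next
      case (Ghost e)
      then have e: "e \<in> arcs G"
        using x by (auto simp: generators_def)
      have "reducible [Vertex (head G e), Ghost e]"
        using reducible_normal_word[of "[]" "head G e" "[e]"] e
        by (simp add: normal_word_def is_path_simps)
      then show ?thesis
        using word_equiv_sym[OF word_relations(5)[OF e]] True Ghost reducible_equiv by simp
    qed
  next
    case False
    then have "reducible xs"
      using Cons by simp
    then consider "word_null xs" | p v q where "is_path (p, v)" "is_path (q, v)"
      "word_equiv xs (letters (normal_word p v q))"
      unfolding reducible_def by blast
    then show ?thesis
    proof cases
      case 1
      then have "word_null (x # xs)"
        using word_null_context[of xs "[x]" "[]"] x by simp
      then show ?thesis
        by (simp add: reducible_def)
    next
      case 2
      then have "word_equiv (x # xs) (x # letters (normal_word p v q))"
        using word_equiv_context[of xs _ "[x]" "[]"] x by simp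
      then show ?thesis
        using step[OF 2(1,2)] by (rule reducible_equiv)
    qed
  qed
qed simp

section \<open>Existence of normal forms\<close>

definition normal_words :: "('v, 'e) generator word set" where
  "normal_words = {normal_word p v q | p v q. is_path (p, v) \<and> is_path (q, v)}"

lemma normal_wordsI: "is_path (p, v) \<Longrightarrow> is_path (q, v) \<Longrightarrow> normal_word p v q \<in> normal_words"
  unfolding normal_words_def by blast

lemma normal_in_carrier: "Poly_Mapping.keys y \<subseteq> normal_words \<Longrightarrow> y \<in> carrier F"
  using letters_normal_word normal_word_not_Nil
  by (fastforce simp: carrier_free_nonunital_algebra normal_words_def)

text \<open>Monomials are reduced one by one, and closure of \<open>J\<close> under scalars carries
  the coefficients along. Only existence is claimed; independence of the normal words enters through
  \<open>detect_normal_key\<close>.\<close>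

lemma normal_form:
  assumes "x \<in> carrier F"
  obtains y where "Poly_Mapping.keys y \<subseteq> normal_words" "x - y \<in> J"
proof -
  let ?N = "\<lambda>x. \<exists>y. Poly_Mapping.keys y \<subseteq> normal_words \<and> x - y \<in> J"
  have single: "?N (Poly_Mapping.single w c)" if "w \<in> Poly_Mapping.keys x" for w c
  proof -
    have "letters w \<noteq> []" "set (letters w) \<subseteq> generators G"
      using that assms by (auto simp: carrier_free_nonunital_algebra)
    then have "reducible (letters w)"
      by (rule reducible_all)
    then consider "word_null (letters w)" | p v q where "is_path (p, v)" "is_path (q, v)"
      "word_equiv (letters w) (letters (normal_word p v q))"
      unfolding reducible_def by blast
    then show ?thesis
    proof cases
      case 1
      then have "scale c (Poly_Mapping.single w 1) \<in> J"
        unfolding word_null_def by (intro J_scale) simp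
      then show ?thesis
        by (intro exI[of _ 0]) (simp add: scale_def mult_single)
    next
      case 2
      then have "scale c (Poly_Mapping.single w 1 - Poly_Mapping.single (normal_word p v q) 1) \<in> J"
        unfolding word_equiv_def by (intro J_scale) simp
      then show ?thesis
        using 2(1,2)
        by (intro exI[of _ "Poly_Mapping.single (normal_word p v q) c"])
          (auto simp: scale_def mult_single right_diff_distrib normal_words_def)
    qed
  qed
  have add: "?N (x + y)" if xy: "?N x" "?N y" for x y
  proof -
    obtain x' y' where "Poly_Mapping.keys x' \<subseteq> normal_words" "x - x' \<in> J"
      "Poly_Mapping.keys y' \<subseteq> normal_words" "y - y' \<in> J"
      using xy by blast
    then show ?thesis
      using keys_add[of x' y'] J_add[of "x - x'" "y - y'"]
      by (intro exI[of _ "x' + y'"]) (auto simp: algebra_simps)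
  qed
  have zero: "?N 0"
    using J_zero by (intro exI[of _ 0]) simp
  have "?N (\<Sum>w\<in>A. Poly_Mapping.single w (Poly_Mapping.lookup x w))"
    if "finite A" "A \<subseteq> Poly_Mapping.keys x" for A
    using that
  proof (induction A)
    case (insert w A)
    then show ?case
      using add[OF single[of w "Poly_Mapping.lookup x w"]] by simp
  qed (use zero in simp)
  from this[of "Poly_Mapping.keys x"] show ?thesis
    using that by (auto simp: sum_single_lookup)
qed

end

section \<open>Graphs of descending edges on a well-order\<close>

context leavitt_no_regular
begin

lemma dual_act_cong:
  assumes "x \<in> carrier F" "is_path \<eta>" "\<And>\<zeta>. is_path \<zeta> \<Longrightarrow> snd \<zeta> = snd \<eta> \<Longrightarrow> f \<zeta> = g \<zeta>"
  shows "dual_act x f \<eta> = dual_act x g \<eta>"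
  unfolding dual_act_def
proof (rule linear_extend_cong)
  fix w
  assume "w \<in> Poly_Mapping.keys x"
  then have w: "set (letters w) \<subseteq> generators G"
    using assms(1) by (simp add: carrier_free_nonunital_algebra)
  show "(case word_act w \<eta> of None \<Rightarrow> 0 | Some \<zeta> \<Rightarrow> f \<zeta>) = (case word_act w \<eta> of None \<Rightarrow> 0 | Some \<zeta> \<Rightarrow> g \<zeta>)"
    using word_act_is_path[OF w assms(2)] assms(3) by (auto split: option.split simp del: split_paired_All)
qed

lemma dual_act_mult_right: "dual_act x (\<lambda>\<xi>. c * f \<xi>) \<eta> = c * dual_act x f \<eta>"
  unfolding dual_act_def linear_extend_def
  by (auto simp: sum_distrib_left intro!: sum.cong split: option.split)

lemma dual_act_normal_form:
  assumes "x - y \<in> J" "is_path \<eta>"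
  shows "dual_act x f \<eta> = dual_act y f \<eta>"
proof -
  have "dual_act (x - y) f \<eta> = 0"
    using assms leavitt_ideal_annihilator[of UNIV] by (intro dual_act_annihilator[where S = UNIV]) auto
  then show ?thesis
    by (simp add: dual_act_diff)
qed

lemma annihilator_carrier: "annihilator S \<subseteq> carrier F"
  by (auto simp: annihilator_def)

lemma annihilator_antimono: "S \<subseteq> T \<Longrightarrow> annihilator T \<subseteq> annihilator S"
  unfolding annihilator_def by blast

lemma annihilator_empty: "annihilator {} = carrier F"
  by (simp add: annihilator_def)

end

definition indicator_fun :: "'x \<Rightarrow> 'x \<Rightarrow> 'k::field" where
  "indicator_fun z = (\<lambda>y. if y = z then 1 else 0)"

text \<open>A vertex a stands for the order type of \<open>underS r a\<close>. If \<open>l\<close>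
  is the least element, the graph is empty and the algebra is zero, of Loewy length 0.\<close>

locale loewy_digraph = wf_digraph G for G :: "('v, 'e) pre_digraph" (structure) +
  fixes K :: "'k::field itself" and r :: "'v rel" and l :: 'v
  assumes well_order: "Well_order r" and l: "l \<in> Field r"
    and verts: "verts G = underS r l"
    and arcs_descend: "e \<in> arcs G \<Longrightarrow> head G e \<in> underS r (tail G e)"
    and infinite_arcs: "\<lbrakk>a \<in> verts G; b \<in> underS r a\<rbrakk> \<Longrightarrow> infinite {e \<in> arcs G. tail G e = a \<and> head G e = b}"
begin

sublocale leavitt_no_regular G K
proof
  fix v
  show "\<not> regular_vertex G v"
  proof
    assume "regular_vertex G v"
    then obtain e where v: "v \<in> verts G" "finite (out_arcs G v)" "e \<in> arcs G" "tail G e = v"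
      by (auto simp: regular_vertex_def out_arcs_def)
    \<comment> \<open>A vertex that emits one edge emits infinitely many parallel to it.\<close>
    have "infinite {e' \<in> arcs G. tail G e' = v \<and> head G e' = head G e}"
      using v arcs_descend by (intro infinite_arcs) auto
    moreover have "{e' \<in> arcs G. tail G e' = v \<and> head G e' = head G e} \<subseteq> out_arcs G v"
      by (auto simp: out_arcs_def)
    ultimately show False
      using v(2) finite_subset by blast
  qed
qed

sublocale r: wo_rel r
  using well_order by (simp add: wo_rel_def)

lemma r_refl: "a \<in> Field r \<Longrightarrow> (a, a) \<in> r"
  using r.REFL by (simp add: refl_on_def)

lemma r_trans: "(a, b) \<in> r \<Longrightarrow> (b, c) \<in> r \<Longrightarrow> (a, c) \<in> r"
  using r.TRANS by (rule transD)

lemma r_antisym: "(a, b) \<in> r \<Longrightarrow> (b, a) \<in> r \<Longrightarrow> a = b"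
  using r.ANTISYM by (rule antisymD)

lemma r_total: "a \<in> Field r \<Longrightarrow> b \<in> Field r \<Longrightarrow> (a, b) \<in> r \<or> (b, a) \<in> r"
  using r.TOTALS by blast

lemma r_Field: "(a, b) \<in> r \<Longrightarrow> a \<in> Field r" "(a, b) \<in> r \<Longrightarrow> b \<in> Field r"
  by (auto simp: Field_def)

lemma verts_Field: "v \<in> verts G \<Longrightarrow> v \<in> Field r"
  using verts by (auto simp: underS_def Field_def)

text \<open>Every edge goes to a smaller vertex. That a path from a vertex to itself is empty gives
  acyclicity, and it makes a vertex a behave like a sink as far as paths with range a are
  concerned.\<close>

lemma path_descends:
  "is_path (p, v) \<Longrightarrow> (v, path_source (p, v)) \<in> r \<and> (p \<noteq> [] \<longrightarrow> path_source (p, v) \<noteq> v)"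
proof (induction p)
  case (Cons e p)
  then have "(v, head G e) \<in> r" "e \<in> arcs G"
    by (auto simp: is_path_simps)
  then show ?case
    using arcs_descend[of e] r_trans r_antisym by (auto simp: underS_def)
qed (auto simp: is_path_simps verts_Field r_refl)

text \<open>A monomial p q* with range v that does not kill \<eta> = q b leaves a path b from v to
  the range of \<eta>, and paths descend.\<close>

lemma normal_key_above:
  assumes "Poly_Mapping.keys y \<subseteq> normal_words" "is_path \<eta>" "dual_act y f \<eta> \<noteq> 0"
  obtains p v q where "normal_word p v q \<in> Poly_Mapping.keys y" "v \<in> verts G" "(snd \<eta>, v) \<in> r"
proof -
  obtain w \<zeta> where w: "w \<in> Poly_Mapping.keys y" "word_act w \<eta> = Some \<zeta>"
    using assms(3) dual_act_zero_fun[of y \<eta> f] by blast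
  then obtain p v q where pvq: "w = normal_word p v q" "is_path (p, v)"
    using assms(1) by (auto simp: normal_words_def)
  then obtain b where b: "\<eta> = (q @ b, snd \<eta>)" "path_source (b, snd \<eta>) = v"
    using w(2) word_act_normal_word[OF pvq(2)] by blast
  have "is_path (b, snd \<eta>)"
    using assms(2) b(1) by (metis is_path_append)
  then have "(snd \<eta>, v) \<in> r"
    using path_descends b(2) by blast
  then show ?thesis
    using that w(1) pvq is_path_in_arcs by blast
qed

text \<open>
  Among the monomials \<open>p q\<^sup>*\<close> of \<open>y\<close> with range above \<open>a\<close>, take one with \<open>q\<close> as short as possible.
  It maps \<open>q b\<close> to \<open>p b\<close>, where \<open>b\<close> is an edge to \<open>a\<close> that does not occur in \<open>y\<close>,
  and no other monomial does.
\<close>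
lemma detect_normal_key:
  assumes y: "Poly_Mapping.keys y \<subseteq> normal_words" and a: "a \<in> verts G"
    and key: "normal_word p1 v1 q1 \<in> Poly_Mapping.keys y" "(a, v1) \<in> r"
  obtains \<zeta> \<eta> where "is_path \<zeta>" "snd \<zeta> = a" "is_path \<eta>" "snd \<eta> = a"
    "dual_act y (indicator_fun \<zeta>) \<eta> \<noteq> 0"
proof -
  define Q where "Q = (\<lambda>(p, v, q). normal_word p v q \<in> Poly_Mapping.keys y \<and> (a, v) \<in> r)"
  have "Q (p1, v1, q1)"
    using key by (simp add: Q_def)
  then obtain t where t: "Q t" "\<And>s. Q s \<Longrightarrow> length (snd (snd t)) \<le> length (snd (snd s))"
    using ex_has_least_nat[of Q "(p1, v1, q1)" "\<lambda>t. length (snd (snd t))"] by blast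
  obtain p0 v0 q0 where t_eq: "t = (p0, v0, q0)"
    by (cases t)
  have min: "length q0 \<le> length q" if "normal_word p v q \<in> Poly_Mapping.keys y" "(a, v) \<in> r" for p v q
    using t(2)[of "(p, v, q)"] that by (simp add: Q_def t_eq)
  have key0: "normal_word p0 v0 q0 \<in> Poly_Mapping.keys y" "(a, v0) \<in> r"
    using t(1) by (simp_all add: Q_def t_eq)
  have paths: "is_path (p0, v0)" "is_path (q0, v0)"
    using key0(1) y by (auto simp: normal_words_def normal_word_inject)
  \<comment> \<open>Ghosts are all that must be avoided: a new edge could only be mistaken for the
    continuation of \<open>q0\<close> in the star factor of another monomial.\<close>
  let ?E = "\<Union>w\<in>Poly_Mapping.keys y. {e. Ghost e \<in> set (letters w)}"
  have "finite {e. Ghost e \<in> set xs}" for xs :: "('v, 'e) generator list"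
    by (rule finite_subset[OF _ finite_imageI[of "set xs" "\<lambda>g. case g of Ghost e \<Rightarrow> e | _ \<Rightarrow> undefined"]])
      (auto intro: rev_image_eqI)
  then have finE: "finite ?E"
    by simp
  \<comment> \<open>If \<open>v0 = a\<close>, the empty path takes the place of the connecting
    edge.\<close>
  obtain bs where bs: "is_path (bs, a)" "path_source (bs, a) = v0" "set bs \<inter> ?E = {}"
  proof (cases "v0 = a")
    case True
    then show ?thesis
      using that[of "[]"] a by (simp add: is_path_simps)
  next
    case False
    then have "infinite {e \<in> arcs G. tail G e = v0 \<and> head G e = a}"
      using key0(2) is_path_in_arcs[OF paths(1)] by (intro infinite_arcs) (auto simp: underS_def)
    then have "infinite ({e \<in> arcs G. tail G e = v0 \<and> head G e = a} - ?E)"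
      by (rule Diff_infinite_finite[OF finE])
    then have "{e \<in> arcs G. tail G e = v0 \<and> head G e = a} - ?E \<noteq> {}"
      by (rule infinite_imp_nonempty)
    then obtain e where "e \<in> arcs G" "tail G e = v0" "head G e = a" "e \<notin> ?E"
      by blast
    then show ?thesis
      using that[of "[e]"] a by (simp add: is_path_simps)
  qed
  let ?\<zeta> = "(p0 @ bs, a)" and ?\<eta> = "(q0 @ bs, a)"
  have path\<eta>: "is_path ?\<eta>" and path\<zeta>: "is_path ?\<zeta>"
    using bs paths by (simp_all add: is_path_append)
  have unique: "w = normal_word p0 v0 q0" if w: "w \<in> Poly_Mapping.keys y" "word_act w ?\<eta> = Some ?\<zeta>" for w
  proof -
    obtain p v q where pvq: "w = normal_word p v q" "is_path (p, v)"
      using w(1) y by (auto simp: normal_words_def)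
    then obtain b where b: "q0 @ bs = q @ b" "path_source (b, a) = v" "p0 @ bs = p @ b"
      using w(2) word_act_normal_word[OF pvq(2)] by auto
    have "is_path (b, a)"
      using path\<eta> b(1) by (simp add: is_path_append)
    then have "length q0 \<le> length q"
      using min[of p v q] w(1) pvq path_descends b(2) by blast
    then obtain c where c: "q = q0 @ c" "bs = c @ b"
      using b(1) by (auto simp: append_eq_append_conv2)
    \<comment> \<open>The list \<open>c\<close> is the part by which \<open>q\<close> extends
      \<open>q0\<close>. Its edges occur as ghosts in \<open>y\<close>, but it is also an initial
      piece of \<open>bs\<close>, which avoids them.\<close>
    have "set c \<subseteq> ?E"
      using w(1) pvq c(1) by (force simp: normal_word_def)
    moreover have "set c \<inter> ?E = {}"
      using bs(3) c(2) by auto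
    ultimately have "set c = {}"
      by (metis inf.absorb1)
    then have "c = []"
      by simp
    then show ?thesis
      using b c bs(2) pvq(1) by simp
  qed
  have act0: "word_act (normal_word p0 v0 q0) ?\<eta> = Some ?\<zeta>"
    unfolding word_act_normal_word[OF paths(1)] using bs by auto
  have "dual_act y (indicator_fun ?\<zeta>) ?\<eta> = (\<Sum>w\<in>{normal_word p0 v0 q0}. Poly_Mapping.lookup y w *
      (case word_act w ?\<eta> of None \<Rightarrow> 0 | Some \<xi> \<Rightarrow> indicator_fun ?\<zeta> \<xi>))"
    unfolding dual_act_def linear_extend_def
    by (rule sum.mono_neutral_right)
      (use key0(1) unique in \<open>auto simp: indicator_fun_def split: option.splits if_splits\<close>)
  then have "dual_act y (indicator_fun ?\<zeta>) ?\<eta> \<noteq> 0"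
    using act0 key0(1) by (simp add: indicator_fun_def in_keys_iff)
  then show ?thesis
    using that[OF path\<zeta> _ path\<eta>] by simp
qed

section \<open>Annihilators of up-closed sets and the layers of the series\<close>

definition up_closed :: "'v set \<Rightarrow> bool" where
  "up_closed S \<longleftrightarrow> (\<forall>v\<in>S. \<forall>u\<in>verts G. (v, u) \<in> r \<longrightarrow> u \<in> S)"

text \<open>A monomial with range v in \<open>S\<close> is detected by paths with range v.
  Conversely, monomials act only on paths whose range is at most their own, so for up-closed
  \<open>S\<close> those with range outside \<open>S\<close> kill all paths with range in
  \<open>S\<close>.\<close>

lemma annihilator_iff_keys:
  assumes "up_closed S" "x \<in> carrier F" "x - y \<in> J" "Poly_Mapping.keys y \<subseteq> normal_words"
  shows "x \<in> annihilator S \<longleftrightarrow> (\<forall>p v q. normal_word p v q \<in> Poly_Mapping.keys y \<longrightarrow> v \<notin> S)"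
proof
  assume x: "x \<in> annihilator S"
  show "\<forall>p v q. normal_word p v q \<in> Poly_Mapping.keys y \<longrightarrow> v \<notin> S"
  proof (intro allI impI notI)
    fix p v q
    assume *: "normal_word p v q \<in> Poly_Mapping.keys y" "v \<in> S"
    then have v: "v \<in> verts G"
      using assms(4) is_path_in_arcs by (auto simp: normal_words_def normal_word_inject)
    then obtain \<zeta> \<eta> where "is_path \<eta>" "snd \<eta> = v" "dual_act y (indicator_fun \<zeta>) \<eta> \<noteq> 0"
      using detect_normal_key[OF assms(4) v *(1) r_refl[OF verts_Field]] by metis
    then show False
      using dual_act_annihilator[OF x] dual_act_normal_form[OF assms(3)] *(2) by metis
  qed
next
  assume keys: "\<forall>p v q. normal_word p v q \<in> Poly_Mapping.keys y \<longrightarrow> v \<notin> S"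
  have "dual_act x f \<eta> = 0" if \<eta>: "is_path \<eta>" "snd \<eta> \<in> S" for f \<eta>
  proof (rule ccontr)
    assume "dual_act x f \<eta> \<noteq> 0"
    then have "dual_act y f \<eta> \<noteq> 0"
      using dual_act_normal_form[OF assms(3) \<eta>(1)] by metis
    then obtain p v q where "normal_word p v q \<in> Poly_Mapping.keys y" "v \<in> verts G" "(snd \<eta>, v) \<in> r"
      by (rule normal_key_above[OF assms(4) \<eta>(1)])
    then show False
      using keys assms(1) \<eta>(2) by (auto simp: up_closed_def)
  qed
  then show "x \<in> annihilator S"
    using assms(2) unfolding annihilator_def by blast
qed

text \<open>The preimage of the term of the Loewy series with index a. For a vertex a, the range a
  alone decides membership, by \<open>layer_detect\<close>; taking all ranges from a upward makes
  the set up-closed and monotonicity in a immediate.\<close>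

definition layer :: "'v \<Rightarrow> ('v, 'e, 'k) free_algebra set" where
  "layer a = annihilator {v \<in> verts G. (a, v) \<in> r}"

text \<open>The candidate for the following term, stated through a strict inequality so that no
  successor of a has to be named.\<close>

definition next_layer :: "'v \<Rightarrow> ('v, 'e, 'k) free_algebra set" where
  "next_layer a = annihilator {v \<in> verts G. a \<in> underS r v}"

lemma up_closed_layer: "up_closed {v \<in> verts G. (a, v) \<in> r}"
  by (auto simp: up_closed_def intro: r_trans)

lemma up_closed_next_layer: "up_closed {v \<in> verts G. a \<in> underS r v}"
  by (auto simp: up_closed_def underS_def dest: r_trans r_antisym)

lemma dual_act_layer:
  assumes "a \<in> verts G" "x \<in> layer a" "is_path \<eta>" "snd \<eta> = a"
  shows "dual_act x f \<eta> = 0"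
  using assms r_refl[OF verts_Field[OF assms(1)]]
  by (intro dual_act_annihilator[where S = "{v \<in> verts G. (a, v) \<in> r}"]) (auto simp: layer_def)

lemma layer_detect:
  assumes "a \<in> verts G" "x \<in> carrier F" "x \<notin> layer a"
  obtains \<zeta> \<eta> where "is_path \<zeta>" "snd \<zeta> = a" "is_path \<eta>" "snd \<eta> = a"
    "dual_act x (indicator_fun \<zeta>) \<eta> \<noteq> 0"
proof -
  obtain y where y: "Poly_Mapping.keys y \<subseteq> normal_words" "x - y \<in> J"
    using normal_form[OF assms(2)] by blast
  obtain p v q where "normal_word p v q \<in> Poly_Mapping.keys y" "(a, v) \<in> r"
    using annihilator_iff_keys[OF up_closed_layer assms(2) y(2,1)] assms(3) unfolding layer_def by blast
  then obtain \<zeta> \<eta> where "is_path \<zeta>" "snd \<zeta> = a" "is_path \<eta>" "snd \<eta> = a"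
    "dual_act y (indicator_fun \<zeta>) \<eta> \<noteq> 0"
    using detect_normal_key[OF y(1) assms(1)] by metis
  then show ?thesis
    using that dual_act_normal_form[OF y(2)] by metis
qed

text \<open>Faithfulness of the action: every vertex lies above a minimum, so an element of its
  layer has no monomial left in its normal form.\<close>

lemma layer_minimum:
  assumes "a \<in> Field r" "underS r a = {}"
  shows "layer a = J"
proof
  show "J \<subseteq> layer a"
    unfolding layer_def by (rule leavitt_ideal_annihilator)
  show "layer a \<subseteq> J"
  proof
    fix x
    assume x: "x \<in> layer a"
    then have xF: "x \<in> carrier F"
      using annihilator_carrier by (auto simp: layer_def)
    obtain y where y: "Poly_Mapping.keys y \<subseteq> normal_words" "x - y \<in> J"
      using normal_form[OF xF] by blast
    have below: "(a, v) \<in> r" if "v \<in> verts G" for v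
      using assms(2) r_total[OF assms(1) verts_Field[OF that]] r_refl[OF assms(1)]
      by (auto simp: underS_def)
    have "normal_word p v q \<notin> Poly_Mapping.keys y" for p v q
    proof
      assume *: "normal_word p v q \<in> Poly_Mapping.keys y"
      then have v: "v \<in> verts G"
        using y(1) is_path_in_arcs by (auto simp: normal_words_def normal_word_inject)
      then show False
        using annihilator_iff_keys[OF up_closed_layer xF y(2,1)] x * below[OF v]
        unfolding layer_def by blast
    qed
    then have "Poly_Mapping.keys y = {}"
      using y(1) unfolding normal_words_def by blast
    then show "x \<in> J"
      using y(2) by simp
  qed
qed

lemma layer_mono: "(b, a) \<in> r \<Longrightarrow> layer b \<subseteq> layer a"
  unfolding layer_def by (rule annihilator_antimono) (auto intro: r_trans)

text \<open>A normal form has finitely many monomials, and finitely many ranges below a limit are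
  strictly bounded by some smaller ordinal.\<close>

lemma layer_limit:
  assumes a: "a \<in> Field r" and ne: "underS r a \<noteq> {}" and lim: "\<nexists>b. immediate_pred r a b"
  shows "layer a = (\<Union>b\<in>underS r a. layer b)"
proof
  show "(\<Union>b\<in>underS r a. layer b) \<subseteq> layer a"
    using layer_mono by (auto simp: underS_def)
  show "layer a \<subseteq> (\<Union>b\<in>underS r a. layer b)"
  proof
    fix x
    assume x: "x \<in> layer a"
    then have xF: "x \<in> carrier F"
      using annihilator_carrier by (auto simp: layer_def)
    obtain y where y: "Poly_Mapping.keys y \<subseteq> normal_words" "x - y \<in> J"
      using normal_form[OF xF] by blast
    have bound: "\<exists>b\<in>underS r a. V \<subseteq> underS r b" if "finite V" "V \<subseteq> underS r a" for V
      using that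
    proof (induction V)
      case (insert v V)
      then obtain b where b: "b \<in> underS r a" "V \<subseteq> underS r b"
        by auto
      \<comment> \<open>As v is no immediate predecessor of a, some c lies strictly between; the
        larger of b and c bounds the enlarged set.\<close>
      have "\<not> immediate_pred r a v" "v \<in> underS r a"
        using lim insert by auto
      then obtain c where c: "c \<in> underS r a" "(c, v) \<notin> r"
        by (auto simp: immediate_pred_def)
      have F: "b \<in> Field r" "c \<in> Field r" "v \<in> Field r"
        using b(1) c(1) insert.prems by (auto simp: underS_def intro: r_Field)
      have vc: "v \<in> underS r c"
        using r_total[OF F(2,3)] c(2) r_refl[OF F(2)] by (auto simp: underS_def)
      have mono: "underS r s \<subseteq> underS r t" if "(s, t) \<in> r" for s t
        using that r_trans r_antisym by (auto simp: underS_def)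
      show ?case
        using r_total[OF F(1,2)] b c(1) vc mono[of b c] mono[of c b] by blast
    qed (use ne in auto)
    let ?V = "{v. \<exists>p q. normal_word p v q \<in> Poly_Mapping.keys y}"
    have sub: "?V \<subseteq> (\<Union>w\<in>Poly_Mapping.keys y. {v. Vertex v \<in> set (letters w)})"
      by (force simp: normal_word_def)
    have "finite {v. Vertex v \<in> set xs}" for xs :: "('v, 'e) generator list"
      by (rule finite_subset[OF _ finite_imageI[of "set xs" "\<lambda>g. case g of Vertex v \<Rightarrow> v | _ \<Rightarrow> undefined"]])
        (auto intro: rev_image_eqI)
    then have fin: "finite ?V"
      by (intro finite_subset[OF sub] finite_UN_I finite_keys)
    have in_verts: "v \<in> verts G" if "normal_word p v q \<in> Poly_Mapping.keys y" for p v q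
      using that y(1) is_path_in_arcs by (auto simp: normal_words_def normal_word_inject)
    have "v \<in> underS r a" if v: "normal_word p v q \<in> Poly_Mapping.keys y" for p v q
    proof -
      have "(a, v) \<notin> r"
        using annihilator_iff_keys[OF up_closed_layer xF y(2,1)] x v in_verts[OF v]
        unfolding layer_def by blast
      then show ?thesis
        using r_total[OF a verts_Field[OF in_verts[OF v]]] r_refl[OF a] by (auto simp: underS_def)
    qed
    then obtain b where b: "b \<in> underS r a" "?V \<subseteq> underS r b"
      using bound[OF fin] by blast
    then have "x \<in> layer b"
      unfolding layer_def annihilator_iff_keys[OF up_closed_layer xF y(2,1)]
      using r_antisym by (fastforce simp: underS_def)
    then show "x \<in> (\<Union>b\<in>underS r a. layer b)"
      using b(1) by blast
  qed
qed

lemma layer_Suc: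
  assumes "immediate_pred r a b"
  shows "layer a = next_layer b"
proof -
  have "(a, v) \<in> r \<longleftrightarrow> b \<in> underS r v" if v: "v \<in> verts G" for v
  proof
    show "(a, v) \<in> r \<Longrightarrow> b \<in> underS r v"
      using assms r_trans r_antisym by (auto simp: immediate_pred_def underS_def)
    show "(a, v) \<in> r" if "b \<in> underS r v"
    proof (rule ccontr)
      assume "(a, v) \<notin> r"
      moreover have "a \<in> Field r"
        using assms by (auto simp: immediate_pred_def underS_def intro: r_Field)
      ultimately have "v \<in> underS r a"
        using r_total[OF _ verts_Field[OF v]] r_refl by (auto simp: underS_def)
      then show False
        using assms \<open>b \<in> underS r v\<close> r_antisym by (auto simp: immediate_pred_def underS_def)
    qed
  qed
  then show ?thesis
    unfolding layer_def next_layer_def by (metis (mono_tags, lifting) Collect_cong)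
qed

lemma layer_top: "layer l = carrier F"
proof -
  have "{v \<in> verts G. (l, v) \<in> r} = {}"
    using verts r_antisym by (auto simp: underS_def)
  then show ?thesis
    by (simp only: layer_def annihilator_empty)
qed

section \<open>Matrix units at a vertex\<close>

definition ghost_path :: "'e list \<Rightarrow> 'v \<Rightarrow> ('v, 'e, 'k) free_algebra" where
  "ghost_path q a = Poly_Mapping.single (normal_word [] a q) 1"

lemma ghost_path_in_carrier:
  assumes "is_path (q, a)"
  shows "ghost_path q a \<in> carrier F"
proof -
  have "is_path ([], a)"
    using is_path_in_arcs[OF assms] by (simp add: is_path_simps)
  with assms show ?thesis
    unfolding ghost_path_def by (intro normal_in_carrier) (auto simp: normal_words_def)
qed

text \<open>A path b from a to a is empty, so among the paths with range a only q itself survives.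
  There \<open>ghost_path q a\<close> acts as the matrix unit in the row of the empty path and the
  column of q, one generator for each column.\<close>

lemma dual_act_ghost_path:
  assumes "is_path (q, a)" "is_path \<xi>" "snd \<xi> = a"
  shows "dual_act (ghost_path q a) f \<xi> = (if \<xi> = (q, a) then f ([], a) else 0)"
proof -
  have a: "is_path ([], a)"
    using is_path_in_arcs[OF assms(1)] by (simp add: is_path_simps)
  have "word_act (normal_word [] a q) \<xi> = (if \<xi> = (q, a) then Some ([], a) else None)"
  proof (cases "\<xi> = (q, a)")
    case True
    then show ?thesis
      using word_act_normal_word[OF a, of q \<xi> "([], a)"] by simp
  next
    case False
    have "word_act (normal_word [] a q) \<xi> \<noteq> Some \<zeta>" for \<zeta>
    proof
      assume "word_act (normal_word [] a q) \<xi> = Some \<zeta>"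
      then obtain b where b: "\<xi> = (q @ b, a)" "path_source (b, a) = a"
        using word_act_normal_word[OF a] assms(3) by blast
      then have "is_path (b, a)"
        using assms(2) by (simp add: is_path_append)
      then have "b = []"
        using path_descends b(2) by blast
      then show False
        using False b(1) by simp
    qed
    then show ?thesis
      using False by (cases "word_act (normal_word [] a q) \<xi>") auto
  qed
  then show ?thesis
    by (simp add: ghost_path_def dual_act_single)
qed

lemma ghost_path_notin_layer:
  assumes "is_path (q, a)"
  shows "ghost_path q a \<notin> layer a"
proof
  have a: "a \<in> verts G"
    using is_path_in_arcs[OF assms] by simp
  assume "ghost_path q a \<in> layer a"
  then have "dual_act (ghost_path q a) (indicator_fun ([], a)) (q, a) = 0"
    using assms by (intro dual_act_layer[OF a]) auto
  then show False
    using assms by (simp add: dual_act_ghost_path indicator_fun_def)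
qed

lemma single_normal_in_annihilator:
  assumes "up_closed S" "is_path (p, v)" "is_path (q, v)" "v \<notin> S"
  shows "Poly_Mapping.single (normal_word p v q) c \<in> annihilator S"
proof -
  have keys: "Poly_Mapping.keys (Poly_Mapping.single (normal_word p v q) c) \<subseteq> normal_words"
    using assms by (auto simp: normal_words_def)
  show ?thesis
    by (subst annihilator_iff_keys[OF assms(1) normal_in_carrier[OF keys] _ keys])
      (use assms(4) in \<open>auto simp: J_zero normal_word_inject split: if_splits\<close>)
qed

lemma ghost_path_in_next_layer:
  assumes "is_path (q, a)"
  shows "ghost_path q a \<in> next_layer a"
  unfolding ghost_path_def next_layer_def
  by (rule single_normal_in_annihilator[OF up_closed_next_layer])
    (use assms is_path_in_arcs[OF assms] in \<open>auto simp: is_path_simps underS_def\<close>)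

lemma algebra_ideal_two_sided: "algebra_ideal K G I \<Longrightarrow> two_sided_ideal F I"
  by (simp add: algebra_ideal_def)

lemma two_sided_ideal_layer: "two_sided_ideal F (layer a)" "two_sided_ideal F (next_layer a)"
  unfolding layer_def next_layer_def
  by (intro algebra_ideal_two_sided algebra_ideal_annihilator)+

lemma layer_subset_next_layer: "layer a \<subseteq> next_layer a"
  unfolding layer_def next_layer_def by (rule annihilator_antimono) (auto simp: underS_def)

lemma J_subset_layer: "J \<subseteq> layer a"
  unfolding layer_def by (rule leavitt_ideal_annihilator)

text \<open>Some x \<eta> has a nonzero coefficient at a path z with range a. The star of z moves
  this coefficient to the empty path, so the product stays outside the layer, while the star itself
  lies in the ideal \<open>next_layer a\<close>.\<close>

lemma layer_essential:
  assumes "a \<in> verts G" "x \<in> carrier F" "x \<notin> layer a"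
  shows "\<exists>b\<in>carrier F. b * x \<in> next_layer a \<and> b * x \<notin> layer a"
proof -
  obtain \<zeta> \<eta> where *: "is_path \<zeta>" "snd \<zeta> = a" "is_path \<eta>" "snd \<eta> = a"
    "dual_act x (indicator_fun \<zeta>) \<eta> \<noteq> 0"
    by (rule layer_detect[OF assms])
  obtain z where z: "\<zeta> = (z, a)"
    using *(2) by (cases \<zeta>) simp
  have pz: "is_path (z, a)"
    using * z by simp
  have "dual_act (ghost_path z a * x) (indicator_fun ([], a)) \<eta> = dual_act x (indicator_fun \<zeta>) \<eta>"
    unfolding dual_act_mult
    by (rule dual_act_cong[OF assms(2) *(3)])
      (simp add: dual_act_ghost_path[OF pz] *(4) z indicator_fun_def)
  then have "ghost_path z a * x \<notin> layer a"
    using dual_act_layer[OF assms(1) _ *(3,4)] *(5) by metis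
  moreover have "ghost_path z a * x \<in> next_layer a"
    using ghost_path_in_next_layer[OF pz] assms(2) algebra_ideal_annihilator
    unfolding next_layer_def algebra_ideal_iff by blast
  ultimately show ?thesis
    using ghost_path_in_carrier[OF pz] by blast
qed

text \<open>On paths with range a, the product sends q to the image under x of the empty path at a,
  and kills the others. If p has coefficient c \<noteq> 0 in this image, then p* divided by c leads
  back to the empty path. The result agrees with q* on all these paths, hence modulo the
  layer.\<close>

lemma ghost_path_return:
  assumes q: "is_path (q, a)" and x: "x \<in> carrier F" and notin: "x * ghost_path q a \<notin> layer a"
  shows "\<exists>b\<in>carrier F. b * (x * ghost_path q a) - ghost_path q a \<in> layer a"
proof -
  let ?n = "ghost_path q a"
  have a: "a \<in> verts G" and nF: "?n \<in> carrier F"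
    using is_path_in_arcs[OF q] ghost_path_in_carrier[OF q] by auto
  obtain \<zeta> \<eta> where *: "is_path \<zeta>" "snd \<zeta> = a" "is_path \<eta>" "snd \<eta> = a"
    "dual_act (x * ?n) (indicator_fun \<zeta>) \<eta> \<noteq> 0"
    by (rule layer_detect[OF a carrier_free_mult[OF x nF] notin])
  obtain p where p: "\<zeta> = (p, a)" "is_path (p, a)"
    using *(1,2) by (cases \<zeta>) simp
  let ?c = "dual_act x (indicator_fun \<zeta>) ([], a)"
  have c: "?c \<noteq> 0"
    using *(5) by (simp add: dual_act_mult dual_act_ghost_path[OF q *(3,4)] split: if_splits)
  let ?b = "scale (1 / ?c) (ghost_path p a)"
  have bF: "?b \<in> carrier F"
    by (intro carrier_free_scale ghost_path_in_carrier p)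
  have aP: "is_path ([], a)"
    using a by (simp add: is_path_simps)
  have b_act: "dual_act ?b f \<xi> = f ([], a) / ?c * indicator_fun \<zeta> \<xi>"
    if "is_path \<xi>" "snd \<xi> = a" for f \<xi>
    using that by (simp add: dual_act_scale dual_act_ghost_path[OF p(2)] p(1) indicator_fun_def)
  have xb: "dual_act x (dual_act ?b f) ([], a) = f ([], a)" for f
  proof -
    have "dual_act x (dual_act ?b f) ([], a) = dual_act x (\<lambda>\<xi>. f ([], a) / ?c * indicator_fun \<zeta> \<xi>) ([], a)"
      by (rule dual_act_cong[OF x aP]) (simp add: b_act)
    then show ?thesis
      unfolding dual_act_mult_right using c by simp
  qed
  have zero: "dual_act (?b * (x * ?n) - ?n) f \<xi> = 0" if "is_path \<xi>" "snd \<xi> = a" for f \<xi>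
    by (simp add: dual_act_diff dual_act_mult dual_act_ghost_path[OF q that] xb)
  have dF: "?b * (x * ?n) - ?n \<in> carrier F"
    by (intro carrier_free_diff carrier_free_mult x bF nF)
  have "?b * (x * ?n) - ?n \<in> layer a"
  proof (rule ccontr)
    assume "?b * (x * ?n) - ?n \<notin> layer a"
    then obtain \<zeta>' \<eta>' where "is_path \<zeta>'" "snd \<zeta>' = a" "is_path \<eta>'" "snd \<eta>' = a"
      "dual_act (?b * (x * ?n) - ?n) (indicator_fun \<zeta>') \<eta>' \<noteq> 0"
      by (rule layer_detect[OF a dF])
    then show False
      using zero by blast
  qed
  then show ?thesis
    using bF by blast
qed

text \<open>Doubling the vertex in the middle exhibits p q* as a left multiple of q*. For
  \<open>p\<close> empty it shows that the vertex is a left unit for q*.\<close>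

lemma vertex_split:
  assumes "is_path (p, a)" "is_path (q, a)"
  shows "Poly_Mapping.single (normal_word p a q) c -
    Poly_Mapping.single (normal_word p a []) c * ghost_path q a \<in> J"
proof -
  have "word_equiv (map Edge p @ [Vertex a, Vertex a] @ map Ghost (rev q))
      (map Edge p @ [Vertex a] @ map Ghost (rev q))"
    by (rule word_equiv_context[OF word_relations(1)])
      (use is_path_in_arcs[OF assms(1)] is_path_in_arcs[OF assms(2)] in auto)
  from J_scale[OF word_equiv_sym[OF this, unfolded word_equiv_def], of c] show ?thesis
    by (simp add: scale_def right_diff_distrib mult_single normal_word_def ghost_path_def plus_word_def
        zero_word_def)
qed

text \<open>All monomials of an element of \<open>next_layer a\<close> have range at most a. Those
  with range below a lie in the layer, and those with range a are left multiples of stars.\<close>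

lemma next_layer_span:
  assumes a: "a \<in> verts G"
  shows "next_layer a \<subseteq> generate (add_monoid F)
    (layer a \<union> (\<Union>n\<in>{ghost_path q a | q. is_path (q, a)}. {x * n | x. x \<in> carrier F}))"
    (is "_ \<subseteq> ?S")
proof
  fix x
  assume x: "x \<in> next_layer a"
  then have xF: "x \<in> carrier F"
    using annihilator_carrier by (auto simp: next_layer_def)
  obtain y where y: "Poly_Mapping.keys y \<subseteq> normal_words" "x - y \<in> J"
    using normal_form[OF xF] by blast
  have layer_S: "u \<in> ?S" if "u \<in> layer a" for u
    using that by (intro generate.incl) blast
  have add: "u + w \<in> ?S" if "u \<in> ?S" "w \<in> ?S" for u w
    using generate.eng[OF that] by simp
  have single: "Poly_Mapping.single w c \<in> ?S" if w: "w \<in> Poly_Mapping.keys y" for w c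
  proof -
    obtain p v q where pvq: "w = normal_word p v q" "is_path (p, v)" "is_path (q, v)"
      using w y(1) by (auto simp: normal_words_def)
    have v: "v \<in> verts G"
      using is_path_in_arcs[OF pvq(2)] by simp
    have nv: "a \<notin> underS r v"
      using annihilator_iff_keys[OF up_closed_next_layer xF y(2,1)] x w pvq(1) v
      unfolding next_layer_def by blast
    show ?thesis
    proof (cases "v = a")
      case True
      let ?d = "Poly_Mapping.single (normal_word p a []) c * ghost_path q a"
      have "Poly_Mapping.single (normal_word p a []) c \<in> carrier F"
        by (rule normal_in_carrier)
          (use pvq True a in \<open>auto intro!: normal_wordsI simp: is_path_simps\<close>)
      then have "?d \<in> ?S"
        using pvq True by (intro generate.incl) blast
      moreover have "Poly_Mapping.single w c - ?d \<in> ?S"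
        using vertex_split[of p a q c] pvq True J_subset_layer by (intro layer_S) blast
      ultimately have "(Poly_Mapping.single w c - ?d) + ?d \<in> ?S"
        by (intro add)
      then show ?thesis
        by simp
    next
      case False
      then have "(a, v) \<notin> r"
        using nv by (auto simp: underS_def)
      then have "Poly_Mapping.single w c \<in> layer a"
        unfolding layer_def pvq(1)
        by (intro single_normal_in_annihilator[OF up_closed_layer] pvq) auto
      then show ?thesis
        by (rule layer_S)
    qed
  qed
  have "(\<Sum>w\<in>A. Poly_Mapping.single w (Poly_Mapping.lookup y w)) \<in> ?S"
    if "finite A" "A \<subseteq> Poly_Mapping.keys y" for A
    using that
  proof (induction A)
    case empty
    show ?case
      using generate.one[of "add_monoid F"] by simp
  next
    case (insert w A)
    then show ?case
      using add[OF single] by simp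
  qed
  from this[of "Poly_Mapping.keys y"] have "y \<in> ?S"
    by (simp add: sum_single_lookup)
  moreover have "x - y \<in> ?S"
    using y(2) J_subset_layer by (intro layer_S) blast
  ultimately have "(x - y) + y \<in> ?S"
    by (intro add)
  then show "x \<in> ?S"
    by simp
qed

section \<open>The Loewy series of the Leavitt path algebra\<close>

sublocale quot: quotient_by_ideal F J
  by unfold_locales (rule algebra_ideal_two_sided[OF algebra_ideal_leavitt_ideal])

abbreviation L where "L \<equiv> leavitt_path_algebra K G"
abbreviation proj where "proj \<equiv> (+>\<^bsub>F\<^esub>) J"

lemma proj_epi: "nonunital_ring_epi F L proj"
  unfolding leavitt_path_algebra_def by (rule quot.quotient_epi)

lemma proj_eq_zero_iff: "x \<in> carrier F \<Longrightarrow> proj x = \<zero>\<^bsub>L\<^esub> \<longleftrightarrow> x \<in> J"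
  unfolding leavitt_path_algebra_def by (rule quot.rcos_eq_zero_iff)

lemma loewy_step_layer:
  assumes a: "a \<in> verts G"
  shows "loewy_step L (proj ` layer a) = proj ` next_layer a"
proof (rule nonunital_ring_epi.loewy_step_image[OF proj_epi,
      where N = "{ghost_path q a | q. is_path (q, a)}"])
  let ?N = "{ghost_path q a | q. is_path (q, a)}"
  show "two_sided_ideal F (layer a)"
    by (rule two_sided_ideal_layer)
  show "left_ideal F (next_layer a)"
    using two_sided_ideal_layer(2) by (simp add: two_sided_ideal_def)
  show "layer a \<subseteq> next_layer a"
    by (rule layer_subset_next_layer)
  show "x \<in> layer a" if "x \<in> carrier F" "proj x = \<zero>\<^bsub>L\<^esub>" for x
    using that proj_eq_zero_iff J_subset_layer by blast
  show "\<exists>b\<in>carrier F. b \<otimes>\<^bsub>F\<^esub> x \<in> next_layer a \<and> b \<otimes>\<^bsub>F\<^esub> x \<notin> layer a"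
    if "x \<in> carrier F" "x \<notin> layer a" for x
    using layer_essential[OF a that] by simp
  show "?N \<subseteq> next_layer a"
    using ghost_path_in_next_layer by blast
  show "n \<notin> layer a" if "n \<in> ?N" for n
    using that ghost_path_notin_layer by blast
  show "\<exists>b\<in>carrier F. b \<otimes>\<^bsub>F\<^esub> n \<ominus>\<^bsub>F\<^esub> n \<in> layer a" if n: "n \<in> ?N" for n
  proof -
    obtain q where q: "n = ghost_path q a" "is_path (q, a)"
      using n by blast
    have aP: "is_path ([], a)"
      using a by (simp add: is_path_simps)
    have F: "ghost_path [] a \<in> carrier F" "n \<in> carrier F"
      using ghost_path_in_carrier aP q by auto
    \<comment> \<open>The element \<open>ghost_path [] a\<close> is the vertex a, a left unit of
      \<open>n\<close> modulo \<open>J\<close>.\<close>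
    have "n - ghost_path [] a * n \<in> J"
      using vertex_split[OF aP q(2), of 1] q(1) by (simp add: ghost_path_def)
    then have "ghost_path [] a * n - n \<in> layer a"
      using J_uminus[of "n - ghost_path [] a * n"] J_subset_layer by auto
    then show ?thesis
      using F by (intro bexI[OF _ F(1)]) (simp add: free_a_minus carrier_free_mult)
  qed
  show "\<exists>b\<in>carrier F. b \<otimes>\<^bsub>F\<^esub> (x \<otimes>\<^bsub>F\<^esub> n) \<ominus>\<^bsub>F\<^esub> n \<in> layer a"
    if n: "n \<in> ?N" and x: "x \<in> carrier F" "x \<otimes>\<^bsub>F\<^esub> n \<notin> layer a" for n x
  proof -
    obtain q where q: "n = ghost_path q a" "is_path (q, a)"
      using n by blast
    have nF: "n \<in> carrier F"
      using ghost_path_in_carrier q by simp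
    obtain b where "b \<in> carrier F" "b * (x * n) - n \<in> layer a"
      using ghost_path_return[OF q(2) x(1)] x(2) q(1) by auto
    then show ?thesis
      using x(1) nF by (intro bexI[of _ b]) (simp_all add: free_a_minus carrier_free_mult)
  qed
  show "next_layer a \<subseteq> generate (add_monoid F)
      (layer a \<union> (\<Union>n\<in>?N. {x \<otimes>\<^bsub>F\<^esub> n | x. x \<in> carrier F}))"
    using next_layer_span[OF a] by simp
qed

text \<open>Induction along the clauses of the series. The bound by \<open>l\<close> makes the
  predecessor in a successor step a vertex, as \<open>loewy_step_layer\<close> demands.\<close>

lemma loewy_series_layer:
  assumes "(a, l) \<in> r"
  shows "loewy_series r L a = proj ` layer a"
  using assms
proof (induction a rule: r.well_order_induct)
  case (1 a)
  have aF: "a \<in> Field r"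
    using 1(2) by (rule r_Field)
  have IH: "loewy_series r L b = proj ` layer b" if "b \<in> underS r a" for b
    using 1 that r_trans by (auto simp: underS_def)
  consider "underS r a = {}" | b where "immediate_pred r a b"
    | "underS r a \<noteq> {}" "\<nexists>b. immediate_pred r a b"
    by blast
  then show ?case
  proof cases
    case 1
    have "proj ` J = {\<zero>\<^bsub>L\<^esub>}"
    proof
      show "proj ` J \<subseteq> {\<zero>\<^bsub>L\<^esub>}"
        using proj_eq_zero_iff J_carrier by (intro image_subsetI) simp
      show "{\<zero>\<^bsub>L\<^esub>} \<subseteq> proj ` J"
        using proj_eq_zero_iff[OF carrier_free_zero] J_zero by (metis empty_subsetI image_eqI insert_subset)
    qed
    then show ?thesis
      by (simp add: loewy_series_zero[OF well_order 1] layer_minimum[OF aF 1])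
  next
    case (2 b)
    then have b: "b \<in> underS r a"
      by (simp add: immediate_pred_def)
    then have "b \<in> verts G"
      using \<open>(a, l) \<in> r\<close> verts r_trans r_antisym by (auto simp: underS_def)
    then show ?thesis
      by (simp add: loewy_series_succ[OF well_order 2] IH[OF b] loewy_step_layer layer_Suc[OF 2])
  next
    case 3
    then show ?thesis
      using IH by (simp add: loewy_series_limit[OF well_order 3] layer_limit[OF aF 3] image_UN)
  qed
qed

lemma loewy_series_top: "loewy_series r L l = carrier L"
  using nonunital_ring_epi.hom_surj[OF proj_epi] r_refl[OF l]
  by (simp add: loewy_series_layer layer_top)

lemma loewy_ring_leavitt: "loewy_ring r L"
  unfolding loewy_ring_def using l loewy_series_top by blast

text \<open>At \<open>l\<close> the series has reached the whole algebra, and the quotient by it is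
  zero. Below \<open>l\<close> it grows strictly, since the vertex a is in the term following the
  one for a, but not in that one.\<close>

lemma has_loewy_length_leavitt: "has_loewy_length r L l"
  unfolding has_loewy_length_def
proof (intro conjI ballI l)
  interpret p: nonunital_ring_epi F L proj
    by (rule proj_epi)
  interpret top: quotient_by_ideal L "carrier L"
    by unfold_locales
      (auto simp: two_sided_ideal_def intro!: p.H.left_idealI)
  have "carrier L \<subseteq> loewy_step L (carrier L)"
  proof
    fix x
    assume x: "x \<in> carrier L"
    then have "carrier L +>\<^bsub>L\<^esub> x = \<zero>\<^bsub>L Quot carrier L\<^esub>"
      by (simp add: top.rcos_eq_zero_iff)
    moreover have "\<zero>\<^bsub>L Quot carrier L\<^esub> \<in> socle (L Quot carrier L)"
      unfolding socle_def using generate.one[of "add_monoid (L Quot carrier L)"] by simp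
    ultimately show "x \<in> loewy_step L (carrier L)"
      using x by (simp add: loewy_step_def)
  qed
  then show "loewy_series r L l = loewy_step L (loewy_series r L l)"
    by (auto simp: loewy_series_top loewy_step_def)
  fix a
  assume a: "a \<in> underS r l"
  then have av: "a \<in> verts G" "(a, l) \<in> r"
    by (auto simp: verts underS_def)
  then have aP: "is_path ([], a)"
    by (simp add: is_path_simps)
  have "proj (ghost_path [] a) \<in> proj ` next_layer a"
    using ghost_path_in_next_layer[OF aP] by blast
  moreover have "proj (ghost_path [] a) \<notin> proj ` layer a"
    using ghost_path_notin_layer[OF aP] ghost_path_in_carrier[OF aP] J_subset_layer
      two_sided_ideal_layer(1) proj_eq_zero_iff
    by (subst p.image_mem_iff) (auto simp: two_sided_ideal_def)
  ultimately show "loewy_series r L a \<noteq> loewy_step L (loewy_series r L a)"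
    using loewy_series_layer[OF av(2)] loewy_step_layer[OF av(1)] by metis
qed

lemma acyclic: "\<not> cycle p"
proof
  assume "cycle p"
  then obtain u where u: "awalk u p u" "p \<noteq> []"
    by (auto simp: cycle_def)
  then have "path_source (p, u) = u"
    by (cases p) (auto simp: awalk_simps)
  moreover have "is_path (p, u)"
    using u by (auto simp: is_path_def)
  ultimately show False
    using path_descends u(2) by blast
qed

end

section \<open>The graph: countably many parallel edges for every descending pair\<close>

definition loewy_graph :: "'o rel \<Rightarrow> 'o \<Rightarrow> ('o, 'o \<times> 'o \<times> nat) pre_digraph" where
  "loewy_graph r l =
    \<lparr>verts = underS r l, arcs = {(a, b, n). a \<in> underS r l \<and> b \<in> underS r a},
      tail = fst, head = fst \<circ> snd\<rparr>"

lemma loewy_digraph_loewy_graph: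
  assumes "Well_order r" "l \<in> Field r"
  shows "loewy_digraph (loewy_graph r l) r l"
proof -
  interpret w: wo_rel r
    using assms(1) by (simp add: wo_rel_def)
  have trans: "b \<in> underS r l" if "a \<in> underS r l" "b \<in> underS r a" for a b
    using that w.TRANS w.ANTISYM by (auto simp: underS_def dest: transD antisymD)
  show ?thesis
  proof
    show "infinite {e \<in> arcs (loewy_graph r l). tail (loewy_graph r l) e = a \<and> head (loewy_graph r l) e = b}"
      if "a \<in> verts (loewy_graph r l)" "b \<in> underS r a" for a b
    proof -
      have "infinite (range (\<lambda>n::nat. (a, b, n)))"
        by (intro range_inj_infinite injI) simp
      moreover have "range (\<lambda>n::nat. (a, b, n)) \<subseteq>
          {e \<in> arcs (loewy_graph r l). tail (loewy_graph r l) e = a \<and> head (loewy_graph r l) e = b}"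
        using that by (auto simp: loewy_graph_def)
      ultimately show ?thesis
        using finite_subset by blast
    qed
  qed (use assms trans in \<open>auto simp: loewy_graph_def\<close>)
qed

theorem theorem4p1:
  fixes r :: "'o rel" and l :: 'o and K :: "'k::field itself"
  assumes "Well_order r" and "l \<in> Field r"
  shows "\<exists>P :: ('o, 'o \<times> 'o \<times> nat) pre_digraph.
    wf_digraph P \<and> \<not> (\<exists>p. pre_digraph.cycle P p) \<and>
    loewy_ring r (leavitt_path_algebra K P) \<and>
    has_loewy_length r (leavitt_path_algebra K P) l"
proof -
  \<comment> \<open>The witness depends on \<open>r\<close> and \<open>l\<close> only, not on the
    field.\<close>
  interpret loewy_digraph "loewy_graph r l" K r l
    using assms by (rule loewy_digraph_loewy_graph)
  show ?thesis
    using wf_digraph acyclic loewy_ring_leavitt has_loewy_length_leavitt by blast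
qed

end
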